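(* Let $a,b,c:\mathbb R\to\mathbb R$ be smooth functions satisfying hypothesis (H), let $m$ be a smooth compactly supported symbol on $\mathbb R^2$, and let $f,g\in\mathcal S(\mathbb R)$. Assume that $\phi(\xi,\eta)=-a(\xi+\eta)+b(\xi)+c(\eta)$ does not vanish on $\operatorname{Supp} m$ (i.e. there are no time resonances). Then the solution $u$ of the system described in the context satisfies, as $t\to\infty$, $$u(t)=e^{ita(D)}F+O\left(\frac1t\right),\qquad F=T_{m/\phi}(f,g).$$
   Context: Hypothesis (H): the second derivatives $a'',b'',c''$ are bounded away from zero. For a symbol $\sigma$ on $\mathbb R^2$, the bilinear Fourier multiplier is $T_\sigma(f,g)(x)=\int_{\mathbb R^2}e^{ix(\xi+\eta)}\widehat f(\xi)\widehat g(\eta)\sigma(\xi,\eta)\,d\xi\,d\eta$ (normalizing constants dropped). $e^{ita(D)}$ denotes the Fourier multiplier with symbol $e^{ita(\xi)}$. The solution $u$ is defined by the system $i\partial_tu+a(D)u=T_m(v,w)$, $i\partial_tv+b(D)v=0$, $i\partial_tw+c(D)w=0$ on $\mathbb R_t\times\mathbb R_x$, with $u(0)=0$, $v(0)=f$, $w(0)=g$; equivalently $u(t)=-ie^{ita(D)}\int_0^tT_{me^{is\phi}}(f,g)\,ds$. *)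

theory Defs
  imports "HOL-Analysis.Analysis"
begin

coinductive smooth_fun :: "('a::real_normed_vector \<Rightarrow> 'b::real_normed_vector) \<Rightarrow> bool" where
  "(\<And>x. (f has_derivative f' x) (at x)) \<Longrightarrow> (\<And>v. smooth_fun (\<lambda>x. f' x v)) \<Longrightarrow> smooth_fun f"

definition schwartz :: "(real \<Rightarrow> complex) \<Rightarrow> bool" where
  "schwartz f \<longleftrightarrow> (\<exists>D :: nat \<Rightarrow> real \<Rightarrow> complex. D 0 = f \<and>
      (\<forall>n x. (D n has_vector_derivative D (Suc n) x) (at x)) \<and>
      (\<forall>n k. \<exists>C. \<forall>x. \<bar>x\<bar> ^ k * norm (D n x) \<le> C))"

definition supp :: "(real \<times> real \<Rightarrow> complex) \<Rightarrow> (real \<times> real) set" where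
  "supp m = closure {z. m z \<noteq> 0}"

definition FT :: "(real \<Rightarrow> complex) \<Rightarrow> real \<Rightarrow> complex" where
  "FT h \<xi> = (LINT x|lborel. cis (- (x * \<xi>)) * h x)"

text \<open>Fourier multiplier e^{i t a(D)}, with the constant 1/(2 pi) making it the identity for t = 0.\<close>
definition mult_op :: "(real \<Rightarrow> real) \<Rightarrow> real \<Rightarrow> (real \<Rightarrow> complex) \<Rightarrow> real \<Rightarrow> complex" where
  "mult_op a t h x = complex_of_real (1 / (2 * pi)) *
      (LINT \<xi>|lborel. cis (x * \<xi>) * cis (t * a \<xi>) * FT h \<xi>)"

text \<open>Bilinear Fourier multiplier T_sigma (normalising constants dropped).\<close>
definition T_bil :: "(real \<times> real \<Rightarrow> complex) \<Rightarrow> (real \<Rightarrow> complex) \<Rightarrow> (real \<Rightarrow> complex) \<Rightarrow> real \<Rightarrow> complex" where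
  "T_bil \<sigma> f g x = (LINT p|lborel. cis (x * (fst p + snd p)) * FT f (fst p) * FT g (snd p) * \<sigma> p)"

definition phase :: "(real \<Rightarrow> real) \<Rightarrow> (real \<Rightarrow> real) \<Rightarrow> (real \<Rightarrow> real) \<Rightarrow> real \<times> real \<Rightarrow> real" where
  "phase a b c p = - a (fst p + snd p) + b (fst p) + c (snd p)"

definition sol :: "(real \<Rightarrow> real) \<Rightarrow> (real \<Rightarrow> real) \<Rightarrow> (real \<Rightarrow> real) \<Rightarrow> (real \<times> real \<Rightarrow> complex)
    \<Rightarrow> (real \<Rightarrow> complex) \<Rightarrow> (real \<Rightarrow> complex) \<Rightarrow> real \<Rightarrow> real \<Rightarrow> complex" where
  "sol a b c m f g t x = - \<i> * mult_op a t
      (\<lambda>y. LBINT s=0..t. T_bil (\<lambda>p. m p * cis (s * phase a b c p)) f g y) x"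

definition hypH :: "(real \<Rightarrow> real) \<Rightarrow> bool" where
  "hypH a \<longleftrightarrow> (\<exists>\<delta>>0. \<forall>x. \<delta> \<le> \<bar>deriv (deriv a) x\<bar>)"

end

theory Submission
  imports Defs "HOL-Probability.Probability"
begin

text \<open>Integrating the oscillating factor in time gives
  \<open>sol = e^{ita(D)} (T_{m/\<phi>}(f,g) - T_{m e^{it\<phi>}/\<phi>}(f,g))\<close>, because \<open>\<phi>\<close> does not vanish on the support of \<open>m\<close>.
  In the error term \<open>e^{ita(D)}\<close> cancels the \<open>a\<close> part of \<open>\<phi>\<close>, which leaves a double integral with the separated phase
  \<open>(t b(\<xi>) + x \<xi>) + (t c(\<eta>) + x \<eta>)\<close> and a fixed compactly supported amplitude \<open>G\<close>. Each one-dimensional factor has a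
  primitive of size \<open>O(t^{-1/2})\<close>, uniformly in \<open>x\<close>, by van der Corput's second derivative test; one integration
  by parts in each variable moves the derivatives to \<open>G\<close> and yields \<open>O(1/t)\<close>.\<close>

subsection \<open>Mixed partial derivatives\<close>

text \<open>The obstacle is that \<open>mult_op\<close> acts through the actual transform
  \<open>FT\<close> of a function of x. Merging e^{ita(D)} with the bilinear integral therefore
  requires Fourier inversion, and inversion requires the bilinear integral to be Lebesgue integrable
  in x. A smooth compactly supported amplitude provides this: integrating by parts once in each
  variable against e^{ix\<xi>} and e^{ix\<eta>} gives decay x^{-2}. The dispersive bound is the same
  estimate with other primitives, so one lemma serves both purposes. Each use consumes exactly one
  derivative per frequency variable; hence all regularity is tracked through the single second-order
  derivative taken first in \<xi> and then in \<eta>, and C^1 information on \<open>FT f\<close> and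
  \<open>FT g\<close> is enough. No two-dimensional stationary phase enters, because the phase of
  the error term has no mixed derivative: the rate 1/t is a product of two one-dimensional rates.
  Uniformity in x comes from x entering the phases only linearly, which leaves their second
  derivatives unchanged.\<close>

definition mixed_deriv ::
    "(real \<times> real \<Rightarrow> 'a::real_normed_vector) \<Rightarrow> (real \<times> real \<Rightarrow> 'a) \<Rightarrow> (real \<times> real \<Rightarrow> 'a) \<Rightarrow> (real \<times> real \<Rightarrow> 'a) \<Rightarrow> bool" where
  "mixed_deriv G G1 G2 G12 \<longleftrightarrow>
     (\<forall>x y. ((\<lambda>s. G (s, y)) has_vector_derivative G1 (x, y)) (at x)) \<and>
     (\<forall>x y. ((\<lambda>s. G (x, s)) has_vector_derivative G2 (x, y)) (at y)) \<and>
     (\<forall>x y. ((\<lambda>s. G1 (x, s)) has_vector_derivative G12 (x, y)) (at y)) \<and>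
     continuous_on UNIV G \<and> continuous_on UNIV G1 \<and> continuous_on UNIV G2 \<and> continuous_on UNIV G12"

lemma mixed_derivD:
  assumes "mixed_deriv G G1 G2 G12"
  shows "((\<lambda>s. G (s, y)) has_vector_derivative G1 (x, y)) (at x)"
    and "((\<lambda>s. G (x, s)) has_vector_derivative G2 (x, y)) (at y)"
    and "((\<lambda>s. G1 (x, s)) has_vector_derivative G12 (x, y)) (at y)"
    and "continuous_on UNIV G" "continuous_on UNIV G1" "continuous_on UNIV G2" "continuous_on UNIV G12"
  using assms by (auto simp: mixed_deriv_def)

lemma mixed_deriv_const: "mixed_deriv (\<lambda>_. c) (\<lambda>_. 0) (\<lambda>_. 0) (\<lambda>_. 0)"
  by (simp add: mixed_deriv_def)

text \<open>The mixed derivative of a product contains \<open>f2 p * g1 p\<close>; this is why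
  \<open>mixed_deriv\<close> records the derivative in the second variable even though it is never
  differentiated again.\<close>

lemma mixed_deriv_mult:
  fixes f g :: "real \<times> real \<Rightarrow> 'a::real_normed_algebra"
  assumes f: "mixed_deriv f f1 f2 f12" and g: "mixed_deriv g g1 g2 g12"
  shows "mixed_deriv (\<lambda>p. f p * g p) (\<lambda>p. f p * g1 p + f1 p * g p) (\<lambda>p. f p * g2 p + f2 p * g p)
           (\<lambda>p. (f p * g12 p + f2 p * g1 p) + (f1 p * g2 p + f12 p * g p))"
  unfolding mixed_deriv_def
  by (intro conjI allI continuous_intros has_vector_derivative_mult has_vector_derivative_add
      mixed_derivD[OF f] mixed_derivD[OF g])

lemma mixed_deriv_diff_const:
  assumes "mixed_deriv f f1 f2 f12"
  shows "mixed_deriv (\<lambda>p. f p - c) f1 f2 f12"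
  using assms unfolding mixed_deriv_def by (simp add: has_vector_derivative_diff_const continuous_on_diff)

text \<open>A function of one variable has zero mixed derivative, so C^1 is enough. With its
  counterpart for \<open>snd\<close> this handles \<open>FT f\<close> and
  \<open>FT g\<close>.\<close>

lemma mixed_deriv_fst:
  assumes "\<And>x. (F has_vector_derivative F' x) (at x)" "continuous_on UNIV F'"
  shows "mixed_deriv (\<lambda>p. F (fst p)) (\<lambda>p. F' (fst p)) (\<lambda>_. 0) (\<lambda>_. 0)"
proof -
  have "continuous_on UNIV F"
    using assms(1) by (auto intro!: continuous_on_vector_derivative)
  then have "continuous_on UNIV (\<lambda>p :: real \<times> real. F (fst p))" "continuous_on UNIV (\<lambda>p :: real \<times> real. F' (fst p))"
    by (rule continuous_on_compose2[OF _ continuous_on_fst[OF continuous_on_id]], simp)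
      (rule continuous_on_compose2[OF assms(2) continuous_on_fst[OF continuous_on_id]], simp)
  then show ?thesis
    unfolding mixed_deriv_def using assms(1) by simp
qed

lemma mixed_deriv_snd:
  assumes "\<And>x. (F has_vector_derivative F' x) (at x)" "continuous_on UNIV F'"
  shows "mixed_deriv (\<lambda>p. F (snd p)) (\<lambda>_. 0) (\<lambda>p. F' (snd p)) (\<lambda>_. 0)"
proof -
  have "continuous_on UNIV F"
    using assms(1) by (auto intro!: continuous_on_vector_derivative)
  then have "continuous_on UNIV (\<lambda>p :: real \<times> real. F (snd p))" "continuous_on UNIV (\<lambda>p :: real \<times> real. F' (snd p))"
    by (rule continuous_on_compose2[OF _ continuous_on_snd[OF continuous_on_id]], simp)
      (rule continuous_on_compose2[OF assms(2) continuous_on_snd[OF continuous_on_id]], simp)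
  then show ?thesis
    unfolding mixed_deriv_def using assms(1) by simp
qed

lemma has_vector_derivative_cis:
  assumes "(h has_vector_derivative h') (at x)"
  shows "((\<lambda>s. cis (h s)) has_vector_derivative (\<i> * complex_of_real h' * cis (h x))) (at x)"
proof -
  have "(h has_derivative (\<lambda>u. h' * u)) (at x)"
    using assms by (simp add: has_vector_derivative_def mult.commute)
  from has_derivative_cis[OF this] show ?thesis
    by (simp add: has_vector_derivative_def scaleR_conv_of_real mult_ac)
qed

lemma has_vector_derivative_complex_of_real:
  assumes "(h has_vector_derivative h') (at x)"
  shows "((\<lambda>s. complex_of_real (h s)) has_vector_derivative complex_of_real h') (at x)"
  using has_vector_derivative_of_real[of h h' "at x"] assms
  by (simp add: has_real_derivative_iff_has_vector_derivative)

lemma mixed_deriv_cis: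
  assumes h: "mixed_deriv h h1 h2 h12"
  shows "mixed_deriv (\<lambda>p. cis (t * h p)) (\<lambda>p. (\<i> * complex_of_real (t * h1 p)) * cis (t * h p))
     (\<lambda>p. (\<i> * complex_of_real (t * h2 p)) * cis (t * h p))
     (\<lambda>p. (\<i> * complex_of_real (t * h1 p)) * ((\<i> * complex_of_real (t * h2 p)) * cis (t * h p))
        + (\<i> * complex_of_real (t * h12 p)) * cis (t * h p))"
  unfolding mixed_deriv_def
  by (intro conjI allI continuous_intros has_vector_derivative_cis has_vector_derivative_mult
       has_vector_derivative_mult_right has_vector_derivative_complex_of_real
      mixed_derivD[OF h])

section \<open>Vanishing off the support, and division by a nonvanishing phase\<close>

lemma open_outside_supp: "open (- supp m)"
  by (simp add: supp_def open_Compl)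

lemma in_supp: "m p \<noteq> 0 \<Longrightarrow> p \<in> supp m"
  unfolding supp_def by (rule subsetD[OF closure_subset]) simp

lemma vector_derivative_zero_locally:
  assumes "(h has_vector_derivative h') (at x)" "open S" "x \<in> S" "\<And>s. s \<in> S \<Longrightarrow> h s = 0"
  shows "h' = 0"
proof -
  have "(h has_vector_derivative 0) (at x)"
    by (rule has_vector_derivative_transform_within_open[of "\<lambda>_. 0", OF _ assms(2,3)])
      (use assms(4) in auto)
  with assms(1) show ?thesis by (rule vector_derivative_unique_at)
qed

lemma open_slice:
  fixes S :: "(real \<times> real) set"
  assumes "open S"
  shows "open {s. (s, y) \<in> S}" "open {s. (x, s) \<in> S}"
  using open_vimage[OF assms, of "\<lambda>s. (s, y)"] open_vimage[OF assms, of "\<lambda>s. (x, s)"]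
  by (simp_all add: vimage_def continuous_on_Pair)

lemma mixed_deriv_zero_outside:
  assumes G: "mixed_deriv G G1 G2 G12" and S: "open S" and zero: "\<And>p. p \<in> S \<Longrightarrow> G p = 0" and p: "p \<in> S"
  shows "G1 p = 0" "G2 p = 0" "G12 p = 0"
proof -
  have 1: "G1 q = 0" if "q \<in> S" for q
    using vector_derivative_zero_locally[OF mixed_derivD(1)[OF G, of "snd q" "fst q"] open_slice(1)[OF S, of "snd q"]] that zero by auto
  show "G1 p = 0" using 1 p .
  show "G2 p = 0"
    using vector_derivative_zero_locally[OF mixed_derivD(2)[OF G, of "fst p" "snd p"] open_slice(2)[OF S, of "fst p"]] p zero by auto
  show "G12 p = 0"
    using vector_derivative_zero_locally[OF mixed_derivD(3)[OF G, of "fst p" "snd p"] open_slice(2)[OF S, of "fst p"]] p 1 by auto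
qed

lemma continuous_on_piecewise_zero:
  fixes h :: "'a::t2_space \<Rightarrow> 'b::real_normed_vector"
  assumes "open S" "\<And>p. p \<in> S \<Longrightarrow> h p = 0" "\<And>p. p \<notin> S \<Longrightarrow> isCont h p"
  shows "continuous_on UNIV h"
proof -
  have "isCont h p" for p
  proof (cases "p \<in> S")
    case True
    have "eventually (\<lambda>q. q \<in> S) (nhds p)" using True assms(1) by (simp add: eventually_nhds_in_open)
    then have "eventually (\<lambda>q. h q = 0) (nhds p)" by (rule eventually_mono) (rule assms(2))
    then show ?thesis using isCont_cong[of h "\<lambda>_. 0" p] by simp
  qed (rule assms(3))
  then show ?thesis by (simp add: continuous_at_imp_continuous_on)
qed

lemma has_vector_derivative_piecewise_zero:
  assumes S: "open S" and z: "\<And>s. s \<in> S \<Longrightarrow> h s = 0"  "x \<in> S \<Longrightarrow> h' = 0"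
    and d: "x \<notin> S \<Longrightarrow> (h has_vector_derivative h') (at x)"
  shows "(h has_vector_derivative h') (at x)"
proof (cases "x \<in> S")
  case True
  show ?thesis
    by (rule has_vector_derivative_transform_within_open[of "\<lambda>_. 0", OF _ S True])
      (use z True in auto)
qed (rule d)

text \<open>Differentiability and continuity are checked point by point. Off \<open>supp m\<close>,
  an open set, the quotient vanishes identically nearby, whatever \<open>h\<close> does there; on
  \<open>supp m\<close> the denominator is nonzero and the quotient rule applies.\<close>

lemma mixed_deriv_divide:
  fixes m :: "real \<times> real \<Rightarrow> complex"
  assumes m: "mixed_deriv m m1 m2 m12" and h: "mixed_deriv h h1 h2 h12"
    and nz: "\<And>p. p \<in> supp m \<Longrightarrow> h p \<noteq> 0"
  shows "\<exists>G1 G2 G12. mixed_deriv (\<lambda>p. m p / complex_of_real (h p)) G1 G2 G12"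
proof -
  define G where "G = (\<lambda>p. m p / complex_of_real (h p))"
  define r where "r = (\<lambda>p. complex_of_real (1 / h p))"
  \<comment> \<open>These are the formal derivatives of \<open>m p * r p\<close>, computed with the
    rule that each partial derivative of \<open>r\<close> is minus that of \<open>h\<close> times
    \<open>r\<close> squared; the factor 2 in \<open>G12\<close> comes from differentiating that
    square.\<close>
  define G1 where "G1 = (\<lambda>p. m1 p * r p - m p * h1 p * r p * r p)"
  define G2 where "G2 = (\<lambda>p. m2 p * r p - m p * h2 p * r p * r p)"
  define G12 where "G12 = (\<lambda>p. m12 p * r p - m1 p * h2 p * r p * r p - m2 p * h1 p * r p * r p
      - m p * h12 p * r p * r p + 2 * m p * h1 p * h2 p * r p * r p * r p)"
  let ?S = "- supp m"
  have m0: "m p = 0" if "p \<in> ?S" for p using in_supp[of m p] that by auto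
  note z = mixed_deriv_zero_outside[OF m open_outside_supp m0]
  have zero: "G p = 0" "G1 p = 0" "G2 p = 0" "G12 p = 0" if "p \<in> ?S" for p
    unfolding G_def G1_def G2_def G12_def using z[OF _ that] m0[OF that] by auto
  have D1: "((\<lambda>s. h (s, y)) has_real_derivative h1 (x, y)) (at x)" for x y
    using mixed_derivD(1)[OF h] by (simp add: has_real_derivative_iff_has_vector_derivative)
  have D2: "((\<lambda>s. h (x, s)) has_real_derivative h2 (x, y)) (at y)" for x y
    using mixed_derivD(2)[OF h] by (simp add: has_real_derivative_iff_has_vector_derivative)
  have D12: "((\<lambda>s. complex_of_real (h1 (x, s))) has_vector_derivative h12 (x, y)) (at y)" for x y
    by (intro has_vector_derivative_complex_of_real mixed_derivD[OF h])
  have r1: "((\<lambda>s. r (s, y)) has_vector_derivative - h1 (x, y) * r (x, y) * r (x, y)) (at x)"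
    if "(x, y) \<in> supp m" for x y
  proof -
    have "((\<lambda>s. 1 / h (s, y)) has_real_derivative - h1 (x,y) * (1 / h (x, y)) * (1 / h (x, y))) (at x)"
      using nz[OF that] by (auto intro!: derivative_eq_intros D1 simp: field_simps)
    then show ?thesis unfolding r_def has_real_derivative_iff_has_vector_derivative
      by (rule has_vector_derivative_complex_of_real[THEN has_vector_derivative_eq_rhs]) auto
  qed
  have r2: "((\<lambda>s. r (x, s)) has_vector_derivative - h2 (x, y) * r (x, y) * r (x, y)) (at y)"
    if "(x, y) \<in> supp m" for x y
  proof -
    have "((\<lambda>s. 1 / h (x, s)) has_real_derivative - h2 (x,y) * (1 / h (x, y)) * (1 / h (x, y))) (at y)"
      using nz[OF that] by (auto intro!: derivative_eq_intros D2 simp: field_simps)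
    then show ?thesis unfolding r_def has_real_derivative_iff_has_vector_derivative
      by (rule has_vector_derivative_complex_of_real[THEN has_vector_derivative_eq_rhs]) auto
  qed
  have Gr: "G = (\<lambda>p. m p * r p)" unfolding G_def r_def by (simp add: divide_inverse)
  have c: "isCont m p" "isCont m1 p" "isCont m2 p" "isCont m12 p" "isCont h p" "isCont h1 p" "isCont h2 p" "isCont h12 p" for p
    using mixed_derivD(4-7)[OF m] mixed_derivD(4-7)[OF h]
    unfolding continuous_on_eq_continuous_at[OF open_UNIV] by blast+
  have cr: "isCont r p" if "p \<notin> ?S" for p
    unfolding r_def using that nz by (intro continuous_intros c) auto
  have "mixed_deriv G G1 G2 G12"
    unfolding mixed_deriv_def
  proof (intro conjI allI)
    show "continuous_on UNIV G"
      by (rule continuous_on_piecewise_zero[OF open_outside_supp[of m]], erule zero, unfold Gr)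
        (intro continuous_intros c cr, assumption+)
    show "continuous_on UNIV G1"
      by (rule continuous_on_piecewise_zero[OF open_outside_supp[of m]], erule zero, unfold G1_def)
        (intro continuous_intros c cr, assumption+)
    show "continuous_on UNIV G2"
      by (rule continuous_on_piecewise_zero[OF open_outside_supp[of m]], erule zero, unfold G2_def)
        (intro continuous_intros c cr, assumption+)
    show "continuous_on UNIV G12"
      by (rule continuous_on_piecewise_zero[OF open_outside_supp[of m]], erule zero, unfold G12_def)
        (intro continuous_intros c cr, assumption+)
    fix x y
    show "((\<lambda>s. G (s, y)) has_vector_derivative G1 (x, y)) (at x)"
    proof (rule has_vector_derivative_piecewise_zero[OF open_slice(1)[OF open_outside_supp[of m], of y]])
      assume "x \<notin> {s. (s, y) \<in> ?S}"
      then have "(x, y) \<in> supp m" by auto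
      then show "((\<lambda>s. G (s, y)) has_vector_derivative G1 (x, y)) (at x)"
        unfolding Gr G1_def
        by (intro has_vector_derivative_eq_rhs[OF has_vector_derivative_mult[OF mixed_derivD(1)[OF m] r1]])
          (auto simp: algebra_simps)
    qed (use zero in auto)
    show "((\<lambda>s. G (x, s)) has_vector_derivative G2 (x, y)) (at y)"
    proof (rule has_vector_derivative_piecewise_zero[OF open_slice(2)[OF open_outside_supp[of m], of x]])
      assume "y \<notin> {s. (x, s) \<in> ?S}"
      then have "(x, y) \<in> supp m" by auto
      then show "((\<lambda>s. G (x, s)) has_vector_derivative G2 (x, y)) (at y)"
        unfolding Gr G2_def
        by (intro has_vector_derivative_eq_rhs[OF has_vector_derivative_mult[OF mixed_derivD(2)[OF m] r2]])
          (auto simp: algebra_simps)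
    qed (use zero in auto)
    show "((\<lambda>s. G1 (x, s)) has_vector_derivative G12 (x, y)) (at y)"
    proof (rule has_vector_derivative_piecewise_zero[OF open_slice(2)[OF open_outside_supp[of m], of x]])
      assume "y \<notin> {s. (x, s) \<in> ?S}"
      then have s: "(x, y) \<in> supp m" by auto
      show "((\<lambda>s. G1 (x, s)) has_vector_derivative G12 (x, y)) (at y)"
        unfolding G1_def G12_def
        by (rule has_vector_derivative_eq_rhs, (rule has_vector_derivative_diff has_vector_derivative_mult
              mixed_derivD(2)[OF m] mixed_derivD(3)[OF m] r2[OF s] D12)+)
          (simp add: algebra_simps)
    qed (use zero in auto)
  qed
  then show ?thesis unfolding G_def by blast
qed

subsection \<open>Smooth functions and the phase\<close>

lemma smooth_funD:
  assumes "smooth_fun f"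
  obtains f' where "\<And>x. (f has_derivative f' x) (at x)" "\<And>v. smooth_fun (\<lambda>x. f' x v)"
  using assms by (cases rule: smooth_fun.cases) blast

lemma smooth_fun_continuous: "smooth_fun f \<Longrightarrow> continuous_on UNIV f"
  by (erule smooth_funD) (meson continuous_at_imp_continuous_on has_derivative_continuous)

lemma smooth_fun_real:
  fixes h :: "real \<Rightarrow> 'a::real_normed_vector"
  assumes "smooth_fun h"
  obtains h' where "\<And>x. (h has_vector_derivative h' x) (at x)" "smooth_fun h'"
proof -
  obtain f' where f: "\<And>x. (h has_derivative f' x) (at x)" "\<And>v. smooth_fun (\<lambda>x. f' x v)"
    using smooth_funD[OF assms] by blast
  have "(h has_vector_derivative f' x 1) (at x)" for x
    unfolding has_vector_derivative_def
    using f(1)[of x]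
  proof (rule has_derivative_eq_rhs)
    show "f' x = (\<lambda>u. u *\<^sub>R f' x 1)"
      using linear_simps(5)[OF has_derivative_bounded_linear[OF f(1)], of x _ 1]
      by (metis mult.right_neutral real_scaleR_def)
  qed
  then show thesis using that[of "\<lambda>x. f' x 1"] f(2)[of 1] by blast
qed

lemma smooth_fun_hypH:
  assumes "smooth_fun h" "hypH h"
  obtains h1 h2 \<delta> where "\<And>x. (h has_real_derivative h1 x) (at x)" "\<And>x. (h1 has_real_derivative h2 x) (at x)"
    "continuous_on UNIV h2" "\<delta> > 0" "\<And>x. \<delta> \<le> \<bar>h2 x\<bar>"
proof -
  obtain h1 where h1: "\<And>x. (h has_vector_derivative h1 x) (at x)" "smooth_fun h1"
    using smooth_fun_real[OF assms(1)] by blast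
  obtain h2 where h2: "\<And>x. (h1 has_vector_derivative h2 x) (at x)" "smooth_fun h2"
    using smooth_fun_real[OF h1(2)] by blast
  have D: "(h has_real_derivative h1 x) (at x)" "(h1 has_real_derivative h2 x) (at x)" for x
    using h1 h2 by (auto simp: has_real_derivative_iff_has_vector_derivative)
  have "deriv h = h1" "deriv h1 = h2" using D DERIV_imp_deriv by blast+
  then show thesis using that D smooth_fun_continuous[OF h2(2)] assms(2) unfolding hypH_def by auto
qed

lemma has_derivative_partials:
  assumes "(m has_derivative m') (at (x, y))"
  shows "((\<lambda>s. m (s, y)) has_vector_derivative m' (1, 0)) (at x)"
    and "((\<lambda>s. m (x, s)) has_vector_derivative m' (0, 1)) (at y)"
proof -
  note lin = linear_simps(5)[OF has_derivative_bounded_linear[OF assms]]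
  have "((\<lambda>s. m (s, y)) has_derivative (\<lambda>s. m' (s, 0))) (at x)"
    by (rule has_derivative_compose[of "\<lambda>s. (s, y)" "\<lambda>s. (s, 0)" x UNIV m m', simplified])
      (auto intro!: derivative_eq_intros assms)
  then show "((\<lambda>s. m (s, y)) has_vector_derivative m' (1, 0)) (at x)"
    unfolding has_vector_derivative_def
    by (rule has_derivative_eq_rhs) (simp add: lin[of _ "(1, 0)", symmetric])
  have "((\<lambda>s. m (x, s)) has_derivative (\<lambda>s. m' (0, s))) (at y)"
    by (rule has_derivative_compose[of "\<lambda>s. (x, s)" "\<lambda>s. (0, s)" y UNIV m m', simplified])
      (auto intro!: derivative_eq_intros assms)
  then show "((\<lambda>s. m (x, s)) has_vector_derivative m' (0, 1)) (at y)"
    unfolding has_vector_derivative_def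
    by (rule has_derivative_eq_rhs) (simp add: lin[of _ "(0, 1)", symmetric])
qed

text \<open>Two unfoldings of the coinduction are enough, in direction (1, 0) and then (0, 1). The
  order of differentiation is fixed, so symmetry of second derivatives does not come up.\<close>

lemma smooth_fun_mixed_deriv:
  assumes "smooth_fun m"
  obtains m1 m2 m12 where "mixed_deriv m m1 m2 m12"
proof -
  obtain m' where m': "\<And>x. (m has_derivative m' x) (at x)" "\<And>v. smooth_fun (\<lambda>x. m' x v)"
    using smooth_funD[OF assms] by blast
  obtain m'' where m'': "\<And>x. ((\<lambda>x. m' x (1, 0)) has_derivative m'' x) (at x)" "\<And>v. smooth_fun (\<lambda>x. m'' x v)"
    using smooth_funD[OF m'(2)] by blast
  have "mixed_deriv m (\<lambda>p. m' p (1, 0)) (\<lambda>p. m' p (0, 1)) (\<lambda>p. m'' p (0, 1))"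
    unfolding mixed_deriv_def
    by (intro conjI allI has_derivative_partials smooth_fun_continuous m' m'' assms)
  then show thesis by (rule that)
qed

text \<open>Only \<open>a\<close> is differentiated twice, because a(\<xi> + \<eta>) is the only
  term that couples the two variables.\<close>

lemma mixed_deriv_phase:
  assumes a: "\<And>x. (a has_real_derivative a1 x) (at x)" "\<And>x. (a1 has_real_derivative a2 x) (at x)" "continuous_on UNIV a2"
    and b: "\<And>x. (b has_real_derivative b1 x) (at x)" "continuous_on UNIV b1"
    and c: "\<And>x. (c has_real_derivative c1 x) (at x)" "continuous_on UNIV c1"
  shows "mixed_deriv (phase a b c) (\<lambda>p. - a1 (fst p + snd p) + b1 (fst p))
    (\<lambda>p. - a1 (fst p + snd p) + c1 (snd p)) (\<lambda>p. - a2 (fst p + snd p))"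
proof -
  have cont: "continuous_on UNIV a" "continuous_on UNIV a1" "continuous_on UNIV b" "continuous_on UNIV c"
    by (rule DERIV_continuous_on, rule has_field_derivative_at_within, rule a b c)+
  have shift: "((\<lambda>s. h (s + y)) has_real_derivative h' (x + y)) (at x)"
      "((\<lambda>s. h (x + s)) has_real_derivative h' (x + y)) (at y)"
    if "\<And>x. (h has_real_derivative h' x) (at x)" for h h' :: "real \<Rightarrow> real" and x y
    using that[of "x + y"] DERIV_shift[of h "h' (x + y)" x y] DERIV_shift[of h "h' (x + y)" y x]
    unfolding add.commute[of _ x] add.commute[of y x] by (auto simp only:)
  have cc: "continuous_on UNIV (\<lambda>p :: real \<times> real. h (fst p + snd p))"
      "continuous_on UNIV (\<lambda>p :: real \<times> real. h (fst p))" "continuous_on UNIV (\<lambda>p :: real \<times> real. h (snd p))"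
    if "continuous_on UNIV h" for h :: "real \<Rightarrow> real"
    by (rule continuous_on_compose2[OF that], intro continuous_intros, simp)+
  have d: "((\<lambda>s. - a (s + y) + b s + c y) has_real_derivative - a1 (x + y) + b1 x) (at x)"
       "((\<lambda>s. - a (x + s) + b x + c s) has_real_derivative - a1 (x + y) + c1 y) (at y)"
       "((\<lambda>s. - a1 (x + s) + b1 x) has_real_derivative - a2 (x + y)) (at y)" for x y
    by (rule DERIV_cong, (rule DERIV_add DERIV_minus shift[OF a(1)] shift(2)[OF a(2)] b(1) c(1) DERIV_const)+, simp)+
  show ?thesis
    unfolding mixed_deriv_def phase_def fst_conv snd_conv
      has_real_derivative_iff_has_vector_derivative[symmetric]
    by (intro conjI allI d continuous_intros cc cont assms)
qed

subsection \<open>Van der Corput's estimate\<close>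

text \<open>Integration by parts based on writing e^{i\<psi>} as the derivative of e^{i\<psi>}
  divided by i\<psi>'. The remaining integrand has modulus |(1/\<psi>')'|, and since \<psi>' is
  nondecreasing it integrates to 1/\<psi>'(\<alpha>) - 1/\<psi>'(\<beta>). The boundary terms add
  the sum of the two values, so the total is 2/\<psi>'(\<alpha>).\<close>

lemma van_der_corput_first:
  fixes U :: "real \<Rightarrow> complex"
  assumes U: "\<And>x. (U has_vector_derivative cis (\<psi> x)) (at x)"
    and \<psi>: "\<And>x. (\<psi> has_real_derivative \<psi>1 x) (at x)"
    and \<psi>1: "\<And>x. (\<psi>1 has_real_derivative \<psi>2 x) (at x)"
    and "\<alpha> \<le> \<beta>" and pos: "\<And>x. \<alpha> \<le> x \<Longrightarrow> \<psi>1 x > 0" and mono: "\<And>x. \<alpha> \<le> x \<Longrightarrow> \<psi>2 x \<ge> 0"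
  shows "norm (U \<beta> - U \<alpha>) \<le> 2 / \<psi>1 \<alpha>"
proof (cases "\<alpha> = \<beta>")
  case True
  then show ?thesis using pos[of \<alpha>] by simp
next
  case False
  define r where "r = (\<lambda>x. 1 / \<psi>1 x)"
  define r' where "r' = (\<lambda>x. - \<psi>2 x / (\<psi>1 x)\<^sup>2)"
  \<comment> \<open>\<open>W\<close> is \<open>U\<close> minus the boundary term
    e^{i\<psi>}/(i\<psi>'); the sign is plus because 1/i = -i.\<close>
  define W where "W = (\<lambda>x. U x + \<i> * (cis (\<psi> x) * complex_of_real (r x)))"
  have r: "(r has_vector_derivative r' x) (at x)" if "\<alpha> \<le> x" for x
    unfolding r_def r'_def has_real_derivative_iff_has_vector_derivative[symmetric]
    using pos[OF that] by (auto intro!: derivative_eq_intros \<psi>1 simp: power2_eq_square)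
  have W: "(W has_vector_derivative \<i> * (cis (\<psi> x) * complex_of_real (r' x))) (at x)" if "\<alpha> \<le> x" for x
  proof -
    have 1: "complex_of_real (\<psi>1 x) * complex_of_real (r x) = 1"
      using pos[OF that] unfolding of_real_mult[symmetric] r_def by simp
    have "(W has_vector_derivative cis (\<psi> x) + \<i> * (cis (\<psi> x) * complex_of_real (r' x)
        + (\<i> * complex_of_real (\<psi>1 x) * cis (\<psi> x)) * complex_of_real (r x))) (at x)"
      unfolding W_def
      by (intro has_vector_derivative_add U has_vector_derivative_mult_right has_vector_derivative_mult
        has_vector_derivative_cis \<psi>[unfolded has_real_derivative_iff_has_vector_derivative]
        has_vector_derivative_complex_of_real r that)
    also have "cis (\<psi> x) + \<i> * (cis (\<psi> x) * complex_of_real (r' x)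
        + (\<i> * complex_of_real (\<psi>1 x) * cis (\<psi> x)) * complex_of_real (r x))
        = \<i> * (cis (\<psi> x) * complex_of_real (r' x)) + cis (\<psi> x) * (1 - complex_of_real (\<psi>1 x) * complex_of_real (r x))"
      by (simp add: algebra_simps)
    finally show ?thesis unfolding 1 by simp
  qed
  have "norm (W \<beta> - W \<alpha>) \<le> (- r \<beta>) - (- r \<alpha>)"
  proof (rule differentiable_bound_general)
    show "\<alpha> < \<beta>" using False \<open>\<alpha> \<le> \<beta>\<close> by simp
    show "continuous_on {\<alpha>..\<beta>} W"
      by (rule continuous_on_vector_derivative, rule has_vector_derivative_at_within, rule W) simp
    show "continuous_on {\<alpha>..\<beta>} (\<lambda>x. - r x)"
      by (intro continuous_on_minus, rule continuous_on_vector_derivative, rule has_vector_derivative_at_within, rule r) simp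
    fix x assume x: "\<alpha> < x" "x < \<beta>"
    show "(W has_vector_derivative \<i> * (cis (\<psi> x) * complex_of_real (r' x))) (at x)" using W x by simp
    show "((\<lambda>x. - r x) has_vector_derivative - r' x) (at x)"
      using r[of x] x by (intro has_vector_derivative_minus) simp
    show "norm (\<i> * (cis (\<psi> x) * complex_of_real (r' x))) \<le> - r' x"
    proof -
      have "norm (\<i> * (cis (\<psi> x) * complex_of_real (r' x))) = \<bar>r' x\<bar>" by (simp add: norm_mult)
      moreover have "r' x \<le> 0" using mono[of x] x by (simp add: r'_def)
      ultimately show ?thesis by simp
    qed
  qed
  moreover have "norm (U \<beta> - U \<alpha>) \<le> norm (W \<beta> - W \<alpha>) + (r \<beta> + r \<alpha>)"
  proof -
    have "U \<beta> - U \<alpha> = (W \<beta> - W \<alpha>) - (\<i> * (cis (\<psi> \<beta>) * complex_of_real (r \<beta>)) - \<i> * (cis (\<psi> \<alpha>) * complex_of_real (r \<alpha>)))"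
      unfolding W_def by simp
    also have "norm \<dots> \<le> norm (W \<beta> - W \<alpha>) + (norm (\<i> * (cis (\<psi> \<beta>) * complex_of_real (r \<beta>))) + norm (\<i> * (cis (\<psi> \<alpha>) * complex_of_real (r \<alpha>))))"
      by (intro order_trans[OF norm_triangle_ineq4] add_left_mono norm_triangle_ineq4)
    also have "\<dots> = norm (W \<beta> - W \<alpha>) + (r \<beta> + r \<alpha>)"
      using pos[of \<alpha>] pos[of \<beta>] \<open>\<alpha> \<le> \<beta>\<close> by (simp add: norm_mult norm_divide r_def)
    finally show ?thesis .
  qed
  ultimately show ?thesis by (simp add: r_def)
qed

text \<open>The interval is cut at distance 1/sqrt \<mu> from the critical point. Up to the cut the
  integral is at most the length; beyond it \<psi>' is at least \<mu> / sqrt \<mu> = sqrt \<mu>, and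
  the first derivative test contributes 2/sqrt \<mu>. This is the origin of the 3.\<close>

lemma van_der_corput_second_right:
  fixes U :: "real \<Rightarrow> complex"
  assumes U: "\<And>x. (U has_vector_derivative cis (\<psi> x)) (at x)"
    and \<psi>: "\<And>x. (\<psi> has_real_derivative \<psi>1 x) (at x)"
    and \<psi>1: "\<And>x. (\<psi>1 has_real_derivative \<psi>2 x) (at x)"
    and \<psi>2: "\<mu> > 0" "\<And>x. \<mu> \<le> \<psi>2 x" and z: "\<psi>1 z = 0" and "z \<le> y"
  shows "norm (U y - U z) \<le> 3 / sqrt \<mu>"
proof -
  define r where "r = 1 / sqrt \<mu>"
  have r: "r > 0" "\<mu> * r = sqrt \<mu>" using \<psi>2(1) by (simp_all add: r_def real_div_sqrt)
  have grow: "\<psi>1 x \<ge> \<mu> * (x - z)" if "z \<le> x" for x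
  proof -
    have "\<psi>1 z - \<mu> * z \<le> \<psi>1 x - \<mu> * x"
      by (rule DERIV_nonneg_imp_nondecreasing[OF that])
        (use \<psi>2(2) in \<open>auto intro!: exI derivative_eq_intros \<psi>1\<close>)
    then show ?thesis using z by (simp add: algebra_simps)
  qed
  have near: "norm (U x - U z) \<le> x - z" if "z \<le> x" for x
  proof (cases "z = x")
    case False
    show ?thesis
    proof (rule differentiable_bound_general[of z x U "\<lambda>x. x" "\<lambda>x. cis (\<psi> x)" "\<lambda>_. 1"])
      show "continuous_on {z..x} U"
        by (rule continuous_on_vector_derivative, rule has_vector_derivative_at_within, rule U)
    qed (use False that U in \<open>auto intro: derivative_intros\<close>)
  qed auto
  show ?thesis
  proof (cases "y \<le> z + r")
    case True
    have "norm (U y - U z) \<le> r" using near[OF \<open>z \<le> y\<close>] True by simp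
    also have "\<dots> \<le> 3 / sqrt \<mu>" unfolding r_def using \<psi>2(1) by (intro divide_right_mono) auto
    finally show ?thesis .
  next
    case False
    have pos: "\<psi>1 x > 0" if "z + r \<le> x" for x
      using grow[of x] that r(1) mult_pos_pos[OF \<psi>2(1), of "x - z"] by simp
    have "norm (U y - U (z + r)) \<le> 2 / \<psi>1 (z + r)"
      by (rule van_der_corput_first[OF U \<psi> \<psi>1]) (use False pos order_trans[OF less_imp_le[OF \<psi>2(1)] \<psi>2(2)] in auto)
    also have "\<dots> \<le> 2 / sqrt \<mu>"
      using grow[of "z + r"] r \<psi>2(1) by (intro divide_left_mono) (auto intro!: mult_pos_pos pos)
    finally have "norm (U y - U z) \<le> 2 / sqrt \<mu> + r"
      using near[of "z + r"] r norm_triangle_ineq[of "U y - U (z + r)" "U (z + r) - U z"] by simp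
    then show ?thesis by (simp add: r_def)
  qed
qed

lemma van_der_corput_second_pos:
  fixes U :: "real \<Rightarrow> complex"
  assumes U: "\<And>x. (U has_vector_derivative cis (\<psi> x)) (at x)"
    and \<psi>: "\<And>x. (\<psi> has_real_derivative \<psi>1 x) (at x)"
    and \<psi>1: "\<And>x. (\<psi>1 has_real_derivative \<psi>2 x) (at x)"
    and \<psi>2: "\<mu> > 0" "\<And>x. \<mu> \<le> \<psi>2 x" and z: "\<psi>1 z = 0"
  shows "norm (U y - U z) \<le> 3 / sqrt \<mu>"
proof (cases "z \<le> y")
  case True
  then show ?thesis using van_der_corput_second_right[OF assms] by simp
next
  case False
  have m: "((\<lambda>x. - x) has_vector_derivative - 1) (at x)" for x :: real
    by (rule has_vector_derivative_minus) (rule has_vector_derivative_id)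
  have "norm (- U (- (- y)) - - U (- (- z))) \<le> 3 / sqrt \<mu>"
  \<comment> \<open>Reflection moves \<open>y\<close> to the right of the critical point. It
    preserves the second derivative of the phase, and the outer minus sign keeps the reflected
    function a primitive.\<close>
  proof (rule van_der_corput_second_right[where U = "\<lambda>x. - U (- x)" and \<psi> = "\<lambda>x. \<psi> (- x)"
          and ?\<psi>1.0 = "\<lambda>x. - \<psi>1 (- x)" and ?\<psi>2.0 = "\<lambda>x. \<psi>2 (- x)"])
    fix x :: real
    show "((\<lambda>x. - U (- x)) has_vector_derivative cis (\<psi> (- x))) (at x)"
      using vector_diff_chain_at[OF m U, of x] by (auto simp: o_def dest: has_vector_derivative_minus)
    show "((\<lambda>x. \<psi> (- x)) has_real_derivative - \<psi>1 (- x)) (at x)"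
      using DERIV_chain2[OF \<psi> DERIV_minus[OF DERIV_ident], of x UNIV] by simp
    show "((\<lambda>x. - \<psi>1 (- x)) has_real_derivative \<psi>2 (- x)) (at x)"
      using DERIV_minus[OF DERIV_chain2[OF \<psi>1 DERIV_minus[OF DERIV_ident], of x UNIV]] by simp
  qed (use False \<psi>2 z in auto)
  then show ?thesis by (simp add: norm_minus_commute)
qed

text \<open>A phase whose second derivative is bounded below has a critical point; normalising the
  primitive there is what makes the bound uniform.\<close>

lemma van_der_corput_primitive_pos:
  assumes \<psi>: "\<And>x. (\<psi> has_real_derivative \<psi>1 x) (at x)"
    and \<psi>1: "\<And>x. (\<psi>1 has_real_derivative \<psi>2 x) (at x)"
    and \<psi>2: "\<mu> > 0" "\<And>x. \<mu> \<le> \<psi>2 x"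
  obtains U where "\<And>x. (U has_vector_derivative cis (\<psi> x)) (at x)" "\<And>x. norm (U x) \<le> 3 / sqrt \<mu>"
proof -
  have grow: "\<mu> * (y - x) \<le> \<psi>1 y - \<psi>1 x" if "x \<le> y" for x y
  proof -
    have "\<psi>1 x - \<mu> * x \<le> \<psi>1 y - \<mu> * y"
      by (rule DERIV_nonneg_imp_nondecreasing[OF that])
        (use \<psi>2(2) in \<open>auto intro!: exI derivative_eq_intros \<psi>1\<close>)
    then show ?thesis by (simp add: algebra_simps)
  qed
  obtain z where z: "\<psi>1 z = 0"
  proof -
    \<comment> \<open>Since \<psi>' grows at rate at least \<mu>, it must change sign within
      distance |\<psi>'(0)|/\<mu> of the origin.\<close>
    define R where "R = \<bar>\<psi>1 0\<bar> / \<mu>"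
    have R: "0 \<le> R" "\<mu> * R = \<bar>\<psi>1 0\<bar>" using \<psi>2(1) by (auto simp: R_def)
    have "\<psi>1 (- R) \<le> 0" "0 \<le> \<psi>1 R" "- R \<le> R"
      using grow[of "- R" 0] grow[of 0 R] R by auto
    moreover have "isCont \<psi>1 x" for x using \<psi>1 by (rule DERIV_isCont)
    ultimately obtain z where "\<psi>1 z = 0" using IVT[of \<psi>1 "- R" 0 R] by blast
    then show thesis by (rule that)
  qed
  have "isCont (\<lambda>x. cis (\<psi> x)) x" for x
    by (rule has_vector_derivative_continuous[OF has_vector_derivative_cis[OF
          \<psi>[unfolded has_real_derivative_iff_has_vector_derivative]]])
  then obtain V where V: "\<And>x. (V has_vector_derivative cis (\<psi> x)) (at x)"
    using einterval_antiderivative[of "-\<infinity>" "\<infinity>" "\<lambda>x. cis (\<psi> x)"] by auto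
  show thesis
  proof (rule that[of "\<lambda>x. V x - V z"])
    show "((\<lambda>x. V x - V z) has_vector_derivative cis (\<psi> x)) (at x)" for x
      using has_vector_derivative_diff[OF V has_vector_derivative_const] by simp
    show "norm (V x - V z) \<le> 3 / sqrt \<mu>" for x
      by (rule van_der_corput_second_pos[OF V \<psi> \<psi>1 \<psi>2 z])
  qed
qed

text \<open>By connectedness a sign change would force a zero. This turns the bound on the absolute
  value in \<open>hypH\<close> into a convex and a concave case.\<close>

lemma continuous_abs_ge_sign:
  fixes h :: "real \<Rightarrow> real"
  assumes "continuous_on UNIV h" "\<delta> > 0" "\<And>x. \<delta> \<le> \<bar>h x\<bar>"
  shows "(\<forall>x. \<delta> \<le> h x) \<or> (\<forall>x. \<delta> \<le> - h x)"
proof (rule ccontr)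
  assume "\<not> ?thesis"
  then obtain x y where "h x \<le> 0" "h y \<ge> 0" using assms(3) by (smt (verit))
  moreover have "connected (range h)"
    using connected_continuous_image[OF assms(1)] by simp
  ultimately have "0 \<in> range h"
    using connectedD_interval[of "range h" "h x" "h y" 0] by blast
  then show False using assms(2,3) by (metis abs_zero imageE not_le)
qed

text \<open>The concave case follows from the convex one by complex conjugation, which replaces
  \<psi> by -\<psi> and preserves moduli.\<close>

lemma van_der_corput_primitive:
  assumes \<psi>: "\<And>x. (\<psi> has_real_derivative \<psi>1 x) (at x)"
    and \<psi>1: "\<And>x. (\<psi>1 has_real_derivative \<psi>2 x) (at x)"
    and \<psi>2: "continuous_on UNIV \<psi>2" "\<mu> > 0" "\<And>x. \<mu> \<le> \<bar>\<psi>2 x\<bar>"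
  obtains U where "\<And>x. (U has_vector_derivative cis (\<psi> x)) (at x)" "\<And>x. norm (U x) \<le> 3 / sqrt \<mu>"
  using continuous_abs_ge_sign[OF \<psi>2]
proof
  assume "\<forall>x. \<mu> \<le> \<psi>2 x"
  then show thesis using van_der_corput_primitive_pos[OF \<psi> \<psi>1 \<psi>2(2)] that by blast
next
  assume "\<forall>x. \<mu> \<le> - \<psi>2 x"
  then obtain U where U: "\<And>x. (U has_vector_derivative cis (- \<psi> x)) (at x)" "\<And>x. norm (U x) \<le> 3 / sqrt \<mu>"
    using van_der_corput_primitive_pos[OF DERIV_minus[OF \<psi>] DERIV_minus[OF \<psi>1] \<psi>2(2)] by blast
  show thesis
  proof (rule that[of "\<lambda>x. cnj (U x)"])
    show "((\<lambda>x. cnj (U x)) has_vector_derivative cis (\<psi> x)) (at x)" for x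
      using has_vector_derivative_cnj[OF U(1)] by (simp add: cis_cnj)
  qed (use U(2) in simp)
qed

subsection \<open>Integration by parts in the plane\<close>

lemma integrable_continuous_compact_support:
  fixes G :: "'a::euclidean_space \<Rightarrow> 'b::{banach, second_countable_topology}"
  assumes "continuous_on UNIV G" "\<And>p. norm p > R \<Longrightarrow> G p = 0"
  shows "integrable lborel G"
proof -
  have "integrable lborel (\<lambda>x. indicator (cball 0 R) x *\<^sub>R G x)"
    by (rule borel_integrable_compact[OF compact_cball continuous_on_subset[OF assms(1)]]) simp
  also have "(\<lambda>x. indicator (cball 0 R) x *\<^sub>R G x) = G"
    using assms(2) by (auto simp: indicator_def fun_eq_iff not_le)
  finally show ?thesis .
qed

lemma bounded_continuous_compact_support:
  fixes G :: "'a::euclidean_space \<Rightarrow> 'b::real_normed_vector"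
  assumes "continuous_on UNIV G" "\<And>p. norm p > R \<Longrightarrow> G p = 0"
  obtains M where "0 \<le> M" "\<And>p. norm (G p) \<le> M"
proof -
  have "compact (G ` cball 0 R)"
    by (rule compact_continuous_image[OF continuous_on_subset[OF assms(1)]]) auto
  then obtain M where M: "M > 0" "\<And>p. norm p \<le> R \<Longrightarrow> norm (G p) \<le> M"
    using bounded_pos[THEN iffD1, OF compact_imp_bounded] by (metis image_eqI mem_cball_0)
  show thesis
  proof (rule that[of M])
    show "norm (G p) \<le> M" for p
      using M assms(2)[of p] by (cases "norm p \<le> R") (auto simp: not_le)
  qed (use M in simp)
qed

lemma LINT_derivative_compact_support:
  fixes h :: "real \<Rightarrow> complex"
  assumes h: "\<And>x. (h has_vector_derivative h' x) (at x)" "continuous_on UNIV h'"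
    and zero: "\<And>x. \<bar>x\<bar> > R \<Longrightarrow> h x = 0"
  shows "(LINT x|lborel. h' x) = 0"
proof -
  \<comment> \<open>\<open>R\<close> may have any sign; this choice makes \<open>S\<close> positive
    and puts both endpoints strictly beyond \<open>R\<close>, where \<open>h\<close>
    vanishes.\<close>
  define S where "S = \<bar>R\<bar> + 1"
  have S: "S > R" "- S \<le> S" "S > 0" by (auto simp: S_def)
  have "open {x::real. R < \<bar>x\<bar>}" by (intro open_Collect_less continuous_intros)
  then have h'0: "h' x = 0" if "\<bar>x\<bar> > R" for x
    using vector_derivative_zero_locally[OF h(1), of "{x. R < \<bar>x\<bar>}" x] zero that by simp
  have "(LINT x|lborel. h' x) = (LINT x|lborel. indicator {- S..S} x *\<^sub>R h' x)"
    using S h'0 by (intro Bochner_Integration.integral_cong) (auto simp: indicator_def)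
  also have "\<dots> = h S - h (- S)"
    by (rule integral_FTC_Icc[OF S(2)])
      (auto intro: h has_vector_derivative_at_within continuous_on_subset[OF h(2)])
  also have "\<dots> = 0" using zero[of S] zero[of "- S"] S by simp
  finally show ?thesis .
qed

lemma LINT_partial_fst_compact_support:
  fixes Z :: "real \<times> real \<Rightarrow> complex"
  assumes Z: "\<And>x y. ((\<lambda>s. Z (s, y)) has_vector_derivative Z' (x, y)) (at x)" "continuous_on UNIV Z'"
    and zero: "\<And>p. norm p > R \<Longrightarrow> Z p = 0" "\<And>p. norm p > R \<Longrightarrow> Z' p = 0"
  shows "(LINT p|lborel. Z' p) = 0"
proof -
  have int: "integrable (lborel \<Otimes>\<^sub>M lborel) (case_prod (\<lambda>x y. Z' (x, y)))"
    using integrable_continuous_compact_support[OF Z(2) zero(2)] by (simp add: lborel_prod)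
  have inner: "(LINT x|lborel. Z' (x, y)) = 0" for y
  proof (rule LINT_derivative_compact_support[OF Z(1), where R = R])
    show "continuous_on UNIV (\<lambda>x. Z' (x, y))"
      by (rule continuous_on_compose2[OF Z(2)]) (auto intro!: continuous_intros)
    show "Z (x, y) = 0" if "\<bar>x\<bar> > R" for x
      using norm_fst_le[of x y] that by (intro zero) simp
  qed
  have "(LINT p|lborel. Z' p) = (LINT y|lborel. (LINT x|lborel. Z' (x, y)))"
    using lborel_pair.integral_snd[OF int] by (simp add: lborel_prod)
  also have "\<dots> = 0" unfolding inner by simp
  finally show ?thesis .
qed

lemma LINT_partial_snd_compact_support:
  fixes Z :: "real \<times> real \<Rightarrow> complex"
  assumes Z: "\<And>x y. ((\<lambda>s. Z (x, s)) has_vector_derivative Z' (x, y)) (at y)" "continuous_on UNIV Z'"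
    and zero: "\<And>p. norm p > R \<Longrightarrow> Z p = 0" "\<And>p. norm p > R \<Longrightarrow> Z' p = 0"
  shows "(LINT p|lborel. Z' p) = 0"
proof -
  have int: "integrable (lborel \<Otimes>\<^sub>M lborel) (case_prod (\<lambda>x y. Z' (x, y)))"
    using integrable_continuous_compact_support[OF Z(2) zero(2)] by (simp add: lborel_prod)
  have inner: "(LINT y|lborel. Z' (x, y)) = 0" for x
  proof (rule LINT_derivative_compact_support[OF Z(1), where R = R])
    show "continuous_on UNIV (\<lambda>y. Z' (x, y))"
      by (rule continuous_on_compose2[OF Z(2)]) (auto intro!: continuous_intros)
    show "Z (x, y) = 0" if "\<bar>y\<bar> > R" for y
      using norm_snd_le[of y x] that by (intro zero) simp
  qed
  have "(LINT p|lborel. Z' p) = (LINT x|lborel. (LINT y|lborel. Z' (x, y)))"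
    using lborel_pair.integral_fst[OF int] by (simp add: lborel_prod)
  also have "\<dots> = 0" unfolding inner by simp
  finally show ?thesis .
qed

lemma norm_gt_open: "open {p::'a::real_normed_vector. R < norm p}"
  by (intro open_Collect_less continuous_intros)

text \<open>Nothing is asked of the oscillating factors except bounded primitives. Moving the
  derivative off \<open>U\<close> and then off \<open>V\<close> costs two minus signs and leaves
  \<open>G12\<close>; compact support removes all boundary terms. It is applied with bounds of order
  t^{-1/2} for the dispersive estimate and 1/|x| for integrability in x.\<close>

lemma oscillatory_integral_bound:
  fixes G :: "real \<times> real \<Rightarrow> complex"
  assumes G: "mixed_deriv G G1 G2 G12" and zero: "\<And>p. norm p > R \<Longrightarrow> G p = 0"
    and U: "\<And>x. (U has_vector_derivative u x) (at x)" "continuous_on UNIV u" "\<And>x. norm (U x) \<le> A"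
    and V: "\<And>x. (V has_vector_derivative v x) (at x)" "continuous_on UNIV v" "\<And>x. norm (V x) \<le> B"
  shows "norm (LINT p|lborel. u (fst p) * v (snd p) * G p) \<le> A * B * (LINT p|lborel. norm (G12 p))"
proof -
  have zeros: "G1 p = 0" "G12 p = 0" if "norm p > R" for p
    using mixed_deriv_zero_outside[OF G norm_gt_open, of R p] zero that by auto
  have cont: "continuous_on UNIV U" "continuous_on UNIV V"
    using U(1) V(1) by (auto intro!: continuous_on_vector_derivative)
  have cc: "continuous_on UNIV (\<lambda>p :: real \<times> real. h (fst p))" "continuous_on UNIV (\<lambda>p :: real \<times> real. h (snd p))"
    if "continuous_on UNIV h" for h :: "real \<Rightarrow> complex"
    by (rule continuous_on_compose2[OF that], intro continuous_intros, simp)+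
  note ci = continuous_on_mult continuous_on_add cc cont U(2) V(2) mixed_derivD(4-)[OF G]
  have int: "integrable lborel (\<lambda>p. U (fst p) * (v (snd p) * G1 p))"
      "integrable lborel (\<lambda>p. u (fst p) * (v (snd p) * G p))"
      "integrable lborel (\<lambda>p. U (fst p) * (V (snd p) * G12 p))"
    by (rule integrable_continuous_compact_support[where R=R], intro ci, simp add: zero zeros)+
  have "(LINT p|lborel. U (fst p) * (v (snd p) * G1 p) + u (fst p) * (v (snd p) * G p)) = 0"
    by (rule LINT_partial_fst_compact_support[of "\<lambda>p. U (fst p) * (v (snd p) * G p)" _ R])
      (auto intro!: ci has_vector_derivative_mult[THEN has_vector_derivative_eq_rhs]
        has_vector_derivative_mult_right U mixed_derivD(1)[OF G] simp: zero zeros)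
  then have 1: "(LINT p|lborel. u (fst p) * (v (snd p) * G p)) = - (LINT p|lborel. U (fst p) * (v (snd p) * G1 p))"
    using int by (simp add: eq_neg_iff_add_eq_0 add.commute)
  have "(LINT p|lborel. U (fst p) * (V (snd p) * G12 p + v (snd p) * G1 p)) = 0"
    by (rule LINT_partial_snd_compact_support[of "\<lambda>p. U (fst p) * (V (snd p) * G1 p)" _ R])
      (auto intro!: ci has_vector_derivative_mult[THEN has_vector_derivative_eq_rhs]
        has_vector_derivative_mult_right V mixed_derivD(3)[OF G] simp: zero zeros)
  then have 2: "(LINT p|lborel. U (fst p) * (V (snd p) * G12 p)) = - (LINT p|lborel. U (fst p) * (v (snd p) * G1 p))"
    using int by (simp add: distrib_left eq_neg_iff_add_eq_0)
  have "norm (LINT p|lborel. u (fst p) * v (snd p) * G p) = norm (LINT p|lborel. U (fst p) * (V (snd p) * G12 p))"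
    unfolding 2 using 1 by (simp add: mult.assoc)
  also have "\<dots> \<le> (LINT p|lborel. norm (U (fst p) * (V (snd p) * G12 p)))"
    by (rule integral_norm_bound)
  also have "\<dots> \<le> (LINT p|lborel. A * B * norm (G12 p))"
  proof (rule integral_mono)
    have "integrable lborel G12"
      by (rule integrable_continuous_compact_support[where R=R]) (auto intro: ci zeros)
    then show "integrable lborel (\<lambda>p. A * B * norm (G12 p))" by simp
    show "norm (U (fst p) * (V (snd p) * G12 p)) \<le> A * B * norm (G12 p)" for p
      using mult_right_mono[OF mult_mono[OF U(3) V(3) _ norm_ge_zero, of "fst p" "snd p"], of "norm (G12 p)"]
        order_trans[OF norm_ge_zero U(3)] by (simp add: norm_mult mult.assoc)
  qed (use int in auto)
  finally show ?thesis by simp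
qed

subsection \<open>Fourier inversion\<close>

lemma LINT_cis_std_normal_density:
  "(LINT x|lborel. cis (t * x) * complex_of_real (std_normal_density x)) = complex_of_real (exp (- t\<^sup>2 / 2))"
proof -
  have "complex_of_real (exp (- t\<^sup>2 / 2)) = char std_normal_distribution t"
    by (simp add: char_std_normal_distribution)
  also have "\<dots> = (LINT x|lborel. std_normal_density x *\<^sub>R iexp (t * x))"
    unfolding char_def by (subst integral_density) (auto simp: normal_density_nonneg)
  also have "\<dots> = (LINT x|lborel. cis (t * x) * complex_of_real (std_normal_density x))"
    by (simp add: cis_conv_exp scaleR_conv_of_real mult_ac)
  finally show ?thesis by simp
qed

lemma borel_measurable_cis [measurable]: "cis \<in> borel_measurable borel"
  by (intro borel_measurable_continuous_onI continuous_intros)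

lemma LINT_cis_scaled_gaussian:
  assumes "\<epsilon> > 0"
  shows "(LINT x|lborel. cis (x * \<tau>) * complex_of_real (std_normal_density (\<epsilon> * x)))
    = complex_of_real (exp (- (\<tau> / \<epsilon>)\<^sup>2 / 2) / \<epsilon>)"
proof -
  have "complex_of_real (exp (- (\<tau> / \<epsilon>)\<^sup>2 / 2))
      = \<epsilon> *\<^sub>R (LINT x|lborel. cis (\<tau> / \<epsilon> * (0 + \<epsilon> * x)) * complex_of_real (std_normal_density (0 + \<epsilon> * x)))"
    unfolding LINT_cis_std_normal_density[symmetric]
    using lborel_integral_real_affine[of \<epsilon> "\<lambda>x. cis (\<tau> / \<epsilon> * x) * complex_of_real (std_normal_density x)" 0] assms
    by simp
  also have "\<dots> = complex_of_real \<epsilon> * (LINT x|lborel. cis (x * \<tau>) * complex_of_real (std_normal_density (\<epsilon> * x)))"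
    using assms by (simp add: scaleR_conv_of_real mult.commute)
  finally show ?thesis using assms by (simp add: field_simps)
qed

lemma integrable_cis_mult:
  assumes "integrable lborel h" "\<theta> \<in> borel_measurable borel"
  shows "integrable lborel (\<lambda>x. cis (\<theta> x) * h x)"
  by (rule Bochner_Integration.integrable_bound[OF assms(1)])
    (use assms borel_measurable_integrable[OF assms(1)] in \<open>auto simp: norm_mult\<close>)

text \<open>Regularising by a Gaussian turns the inversion formula into convergence of a Gaussian average.\<close>

lemma FT_gaussian_average:
  fixes H :: "real \<Rightarrow> complex"
  assumes H: "continuous_on UNIV H" "\<And>\<zeta>. \<bar>\<zeta>\<bar> > R \<Longrightarrow> H \<zeta> = 0" and "\<epsilon> > 0"
  shows "(LINT x|lborel. cis (- (x * \<zeta>)) * (LINT \<eta>|lborel. cis (x * \<eta>) * H \<eta>) * complex_of_real (std_normal_density (\<epsilon> * x)))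
    = complex_of_real (sqrt (2 * pi)) * (LINT u|lborel. H (\<zeta> + \<epsilon> * u) * complex_of_real (std_normal_density u))"
proof -
  have iH: "integrable lborel H"
    by (rule integrable_continuous_compact_support[OF H(1), of R]) (use H(2) in simp)
  have [measurable]: "H \<in> borel_measurable borel"
    using borel_measurable_continuous_onI[OF H(1)] .
  have idens: "integrable lborel (\<lambda>x. std_normal_density (\<epsilon> * x))"
    using lborel_integrable_real_affine[of "std_normal_density" \<epsilon> 0] \<open>\<epsilon> > 0\<close>
    by (simp add: integrable_normal_density)
  \<comment> \<open>The Gaussian makes \<open>f\<close> absolutely integrable in the plane. The
    factor e^{ix\<eta>} H(\<eta>) alone has no decay in x, so the integrals could not be exchanged
    without it.\<close>
  define f where "f = (\<lambda>x \<eta>. cis (x * (\<eta> - \<zeta>)) * complex_of_real (std_normal_density (\<epsilon> * x)) * H \<eta>)"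
  have fi: "integrable (lborel \<Otimes>\<^sub>M lborel) (case_prod f)"
  proof (rule lborel_pair.Fubini_integrable)
    show "case_prod f \<in> borel_measurable (lborel \<Otimes>\<^sub>M lborel)"
      unfolding f_def by measurable
    have "(\<lambda>x. LINT y|lborel. norm (case (x, y) of (x, \<eta>) \<Rightarrow> f x \<eta>))
        = (\<lambda>x. std_normal_density (\<epsilon> * x) * (LINT y|lborel. norm (H y)))"
      by (simp add: f_def norm_mult)
    then show "integrable lborel (\<lambda>x. LINT y|lborel. norm (case (x, y) of (x, \<eta>) \<Rightarrow> f x \<eta>))"
      using idens by simp
    show "AE x in lborel. integrable lborel (\<lambda>y. case (x, y) of (x, \<eta>) \<Rightarrow> f x \<eta>)"
    proof (rule AE_I2)
      fix x
      have "integrable lborel (\<lambda>\<eta>. cis (x * (\<eta> - \<zeta>)) * (complex_of_real (std_normal_density (\<epsilon> * x)) * H \<eta>))"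
        by (rule integrable_cis_mult) (use iH in auto)
      then show "integrable lborel (\<lambda>y. case (x, y) of (x, \<eta>) \<Rightarrow> f x \<eta>)"
        by (simp add: f_def mult.assoc)
    qed
  qed
  have "(LINT x|lborel. cis (- (x * \<zeta>)) * (LINT \<eta>|lborel. cis (x * \<eta>) * H \<eta>) * complex_of_real (std_normal_density (\<epsilon> * x)))
      = (LINT x|lborel. (LINT \<eta>|lborel. f x \<eta>))"
  proof (intro Bochner_Integration.integral_cong refl)
    fix x
    have "f x \<eta> = (cis (- (x * \<zeta>)) * complex_of_real (std_normal_density (\<epsilon> * x))) * (cis (x * \<eta>) * H \<eta>)" for \<eta>
    proof -
      have "cis (x * (\<eta> - \<zeta>)) = cis (- (x * \<zeta>)) * cis (x * \<eta>)" by (simp add: cis_mult algebra_simps)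
      then show ?thesis by (simp add: f_def)
    qed
    then show "cis (- (x * \<zeta>)) * (LINT \<eta>|lborel. cis (x * \<eta>) * H \<eta>) * complex_of_real (std_normal_density (\<epsilon> * x))
       = (LINT \<eta>|lborel. f x \<eta>)"
      by (simp only: integral_mult_right_zero) simp
  qed
  also have "\<dots> = (LINT \<eta>|lborel. (LINT x|lborel. f x \<eta>))"
    using lborel_pair.Fubini_integral[OF fi] by simp
  also have "\<dots> = (LINT \<eta>|lborel. complex_of_real (exp (- ((\<eta> - \<zeta>) / \<epsilon>)\<^sup>2 / 2) / \<epsilon>) * H \<eta>)"
    using LINT_cis_scaled_gaussian[OF \<open>\<epsilon> > 0\<close>] by (simp add: f_def)
  \<comment> \<open>The integration in x has produced a Gaussian of width \<epsilon> centred at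
    \<zeta>; substituting \<eta> = \<zeta> + \<epsilon>u rescales it to unit width.\<close>
  also have "\<dots> = \<epsilon> *\<^sub>R (LINT u|lborel. complex_of_real (exp (- ((\<zeta> + \<epsilon> * u - \<zeta>) / \<epsilon>)\<^sup>2 / 2) / \<epsilon>) * H (\<zeta> + \<epsilon> * u))"
    using \<open>\<epsilon> > 0\<close>
    by (subst lborel_integral_real_affine[where c = \<epsilon> and t = \<zeta>]) auto
  also have "\<dots> = (LINT u|lborel. \<epsilon> *\<^sub>R (complex_of_real (exp (- ((\<zeta> + \<epsilon> * u - \<zeta>) / \<epsilon>)\<^sup>2 / 2) / \<epsilon>) * H (\<zeta> + \<epsilon> * u)))"
    by simp
  also have "\<dots> = (LINT u|lborel. complex_of_real (sqrt (2 * pi)) * (H (\<zeta> + \<epsilon> * u) * complex_of_real (std_normal_density u)))"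
    using \<open>\<epsilon> > 0\<close>
    by (intro Bochner_Integration.integral_cong refl)
      (simp add: std_normal_density_def scaleR_conv_of_real)
  finally show ?thesis by simp
qed

text \<open>Both sides of the Gaussian average are passed to the limit \<epsilon> \<rightarrow> 0.
  On the left integrability of \<open>K\<close> gives a majorant, and the density at 0 leaves a
  factor 1/sqrt(2 pi); on the right continuity of \<open>H\<close> yields sqrt(2 pi) H(\<zeta>). The
  two square roots multiply to 2 pi.\<close>

lemma Fourier_inversion:
  fixes H :: "real \<Rightarrow> complex"
  assumes H: "continuous_on UNIV H" "\<And>\<zeta>. \<bar>\<zeta>\<bar> > R \<Longrightarrow> H \<zeta> = 0"
    and K: "\<And>x. K x = (LINT \<eta>|lborel. cis (x * \<eta>) * H \<eta>)" "integrable lborel K"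
  shows "FT K \<zeta> = 2 * complex_of_real pi * H \<zeta>"
proof -
  define \<epsilon> where "\<epsilon> = (\<lambda>n. 1 / real (Suc n))"
  have \<epsilon>: "\<epsilon> n > 0" "\<epsilon> \<longlonglongrightarrow> 0" for n
    unfolding \<epsilon>_def using LIMSEQ_Suc[OF lim_1_over_n] by auto
  have [measurable]: "H \<in> borel_measurable borel" "K \<in> borel_measurable borel"
    using borel_measurable_continuous_onI[OF H(1)] borel_measurable_integrable[OF K(2)] by auto
  have cont: "isCont H \<zeta>" "isCont std_normal_density 0"
    using H(1) by (auto simp: continuous_on_eq_continuous_at normal_density_def[abs_def] intro!: continuous_intros)
  obtain M where M: "0 \<le> M" "\<And>\<zeta>. norm (H \<zeta>) \<le> M"
    using bounded_continuous_compact_support[OF H(1), of R] H(2) by auto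
  have dens: "std_normal_density x \<le> 1" for x
  proof -
    have "1 \<le> sqrt (2 * pi)" using pi_ge_two by simp
    then have "1 / sqrt (2 * pi) * exp (- x\<^sup>2 / 2) \<le> 1 * 1"
      by (intro mult_mono) auto
    then show ?thesis by (simp add: std_normal_density_def)
  qed
  let ?L = "\<lambda>n. LINT x|lborel. cis (- (x * \<zeta>)) * K x * complex_of_real (std_normal_density (\<epsilon> n * x))"
  have "?L \<longlonglongrightarrow> (LINT x|lborel. cis (- (x * \<zeta>)) * K x * complex_of_real (std_normal_density 0))"
  proof (rule integral_dominated_convergence[where w = "\<lambda>x. norm (K x)"])
    show "AE x in lborel. (\<lambda>n. cis (- (x * \<zeta>)) * K x * complex_of_real (std_normal_density (\<epsilon> n * x)))
        \<longlonglongrightarrow> cis (- (x * \<zeta>)) * K x * complex_of_real (std_normal_density 0)"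
      by (intro AE_I2 tendsto_intros isCont_tendsto_compose[OF cont(2)] tendsto_mult_left_zero \<epsilon>)
    show "AE x in lborel. norm (cis (- (x * \<zeta>)) * K x * complex_of_real (std_normal_density (\<epsilon> n * x))) \<le> norm (K x)" for n
      using dens by (intro AE_I2) (simp add: norm_mult mult_left_le)
  qed (use K(2) in auto)
  then have 1: "?L \<longlonglongrightarrow> FT K \<zeta> / complex_of_real (sqrt (2 * pi))"
    by (simp add: FT_def std_normal_density_def)
  let ?I = "\<lambda>n. LINT u|lborel. H (\<zeta> + \<epsilon> n * u) * complex_of_real (std_normal_density u)"
  have "?I \<longlonglongrightarrow> (LINT u|lborel. H \<zeta> * complex_of_real (std_normal_density u))"
  proof (rule integral_dominated_convergence[where w = "\<lambda>u. M * std_normal_density u"])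
    have "(\<lambda>n. \<zeta> + \<epsilon> n * u) \<longlonglongrightarrow> \<zeta>" for u
      using tendsto_add[OF tendsto_const tendsto_mult_left_zero[OF \<epsilon>(2), of u], of \<zeta>] by simp
    then show "AE u in lborel. (\<lambda>n. H (\<zeta> + \<epsilon> n * u) * complex_of_real (std_normal_density u))
        \<longlonglongrightarrow> H \<zeta> * complex_of_real (std_normal_density u)"
      by (intro AE_I2 tendsto_intros isCont_tendsto_compose[OF cont(1)])
    show "AE u in lborel. norm (H (\<zeta> + \<epsilon> n * u) * complex_of_real (std_normal_density u)) \<le> M * std_normal_density u" for n
      using M by (intro AE_I2) (simp add: norm_mult mult_right_mono)
  qed auto
  also have "(LINT u|lborel. H \<zeta> * complex_of_real (std_normal_density u)) = H \<zeta>"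
    by simp
  finally have "(\<lambda>n. complex_of_real (sqrt (2 * pi)) * ?I n) \<longlonglongrightarrow> complex_of_real (sqrt (2 * pi)) * H \<zeta>"
    by (rule tendsto_mult_left)
  moreover have "?L n = complex_of_real (sqrt (2 * pi)) * ?I n" for n
    unfolding K(1) by (rule FT_gaussian_average[OF H \<epsilon>(1)])
  ultimately have "FT K \<zeta> / complex_of_real (sqrt (2 * pi)) = complex_of_real (sqrt (2 * pi)) * H \<zeta>"
    using LIMSEQ_unique[OF 1] by simp
  then have "FT K \<zeta> = complex_of_real (sqrt (2 * pi) * sqrt (2 * pi)) * H \<zeta>"
    unfolding of_real_mult by (simp add: nonzero_divide_eq_eq mult_ac)
  also have "sqrt (2 * pi) * sqrt (2 * pi) = 2 * pi" by simp
  finally show ?thesis by simp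
qed

text \<open>The total amplitude at output frequency \<zeta> = \<xi> + \<eta>. Up to the factor 2 pi
  it is the Fourier transform of the bilinear integral with amplitude \<open>G\<close>.\<close>

definition convolve_diagonal :: "(real \<times> real \<Rightarrow> complex) \<Rightarrow> real \<Rightarrow> complex" where
  "convolve_diagonal G \<zeta> = (LINT \<eta>|lborel. G (\<zeta> - \<eta>, \<eta>))"

lemma norm_pair_bounds:
  fixes x y :: real
  shows "\<bar>x + y\<bar> \<le> 2 * norm (x, y)" "norm (x + y, y) \<le> 3 * norm (x, y)"
  using norm_fst_le[of x y] norm_snd_le[of y x] norm_Pair_le[of "x + y" y] by auto

text \<open>For fixed \<eta> the substitution \<zeta> = \<xi> + \<eta> is a translation of the line,
  so two applications of Fubini replace a planar change of variables.\<close>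

lemma LINT_diagonal:
  fixes G :: "real \<times> real \<Rightarrow> complex"
  assumes G: "continuous_on UNIV G" "\<And>p. norm p > R \<Longrightarrow> G p = 0" and F: "continuous_on UNIV F"
  shows "(LINT p|lborel. F (fst p + snd p) * G p) = (LINT \<zeta>|lborel. F \<zeta> * convolve_diagonal G \<zeta>)"
proof -
  have cF: "continuous_on UNIV (\<lambda>p. F (fst p + snd p))" "continuous_on UNIV (\<lambda>p::real \<times> real. F (fst p))"
    by (rule continuous_on_compose2[OF F], intro continuous_intros, simp)+
  have int1: "integrable (lborel \<Otimes>\<^sub>M lborel) (case_prod (\<lambda>\<xi> \<eta>. F (\<xi> + \<eta>) * G (\<xi>, \<eta>)))"
    using integrable_continuous_compact_support[of "\<lambda>p. F (fst p + snd p) * G p" R] G cF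
    by (simp add: lborel_prod case_prod_unfold continuous_on_mult)
  have cG: "continuous_on UNIV (\<lambda>p. G (fst p - snd p, snd p))"
    by (rule continuous_on_compose2[OF G(1)], intro continuous_intros, simp)
  \<comment> \<open>The shear (\<xi>, \<eta>) to (\<xi> + \<eta>, \<eta>) enlarges norms by at most
    the factor 3, so the sheared amplitude still has compact support.\<close>
  have zero: "G (fst p - snd p, snd p) = 0" if "norm p > 3 * R" for p
    using norm_pair_bounds(2)[of "fst p - snd p" "snd p"] that by (intro G(2)) simp
  have int2: "integrable (lborel \<Otimes>\<^sub>M lborel) (case_prod (\<lambda>\<zeta> \<eta>. F \<zeta> * G (\<zeta> - \<eta>, \<eta>)))"
    using integrable_continuous_compact_support[of "\<lambda>p. F (fst p) * G (fst p - snd p, snd p)" "3 * R"] cG cF zero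
    by (simp add: lborel_prod case_prod_unfold continuous_on_mult)
  have "(LINT p|lborel. F (fst p + snd p) * G p) = (LINT \<eta>|lborel. (LINT \<xi>|lborel. F (\<xi> + \<eta>) * G (\<xi>, \<eta>)))"
    using lborel_pair.integral_snd[OF int1] by (simp add: lborel_prod case_prod_unfold)
  also have "\<dots> = (LINT \<eta>|lborel. (LINT \<zeta>|lborel. F \<zeta> * G (\<zeta> - \<eta>, \<eta>)))"
  proof -
    have "(LINT \<xi>|lborel. F (\<xi> + \<eta>) * G (\<xi>, \<eta>)) = (LINT \<zeta>|lborel. F \<zeta> * G (\<zeta> - \<eta>, \<eta>))" for \<eta>
      using lborel_integral_real_affine[of 1 "\<lambda>\<xi>. F (\<xi> + \<eta>) * G (\<xi>, \<eta>)" "- \<eta>"] by simp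
    then show ?thesis by simp
  qed
  also have "\<dots> = (LINT \<zeta>|lborel. (LINT \<eta>|lborel. F \<zeta> * G (\<zeta> - \<eta>, \<eta>)))"
    using lborel_pair.Fubini_integral[OF int2] by simp
  finally show ?thesis by (simp add: convolve_diagonal_def)
qed

lemma convolve_diagonal_zero:
  assumes "\<And>p. norm p > R \<Longrightarrow> G p = 0" "\<bar>\<zeta>\<bar> > 2 * R"
  shows "convolve_diagonal G \<zeta> = 0"
proof -
  have "G (\<zeta> - \<eta>, \<eta>) = 0" for \<eta>
    using norm_pair_bounds(1)[of "\<zeta> - \<eta>" \<eta>] assms(2) by (intro assms(1)) simp
  then show ?thesis by (simp add: convolve_diagonal_def)
qed

text \<open>Dominated convergence applies because |\<eta>| is at most the norm of (\<zeta> - \<eta>,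
  \<eta>): all the integrands vanish outside [-R, R], whatever \<zeta> is.\<close>

lemma continuous_on_convolve_diagonal:
  assumes G: "continuous_on UNIV G" "\<And>p. norm p > R \<Longrightarrow> G p = 0"
  shows "continuous_on UNIV (convolve_diagonal G)"
proof -
  obtain M where M: "0 \<le> M" "\<And>p. norm (G p) \<le> M"
    using bounded_continuous_compact_support[OF G] by blast
  have "isCont (convolve_diagonal G) \<zeta>" for \<zeta>
    unfolding continuous_at_sequentially
  proof (intro allI impI)
    fix X assume X: "X \<longlonglongrightarrow> \<zeta>"
    have cG: "continuous_on UNIV (\<lambda>\<eta>. G (z - \<eta>, \<eta>))" for z
      by (rule continuous_on_compose2[OF G(1)], intro continuous_intros, simp)
    show "(convolve_diagonal G \<circ> X) \<longlonglongrightarrow> convolve_diagonal G \<zeta>"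
      unfolding convolve_diagonal_def o_def
    proof (rule integral_dominated_convergence[where w = "\<lambda>\<eta>. indicator {-R..R} \<eta> * M"])
      show "integrable lborel (\<lambda>\<eta>. indicator {-R..R} \<eta> * M)"
        by (intro integrable_mult_left integrable_real_indicator emeasure_bounded_finite) auto
      show "AE \<eta> in lborel. (\<lambda>n. G (X n - \<eta>, \<eta>)) \<longlonglongrightarrow> G (\<zeta> - \<eta>, \<eta>)"
        using G(1) by (intro AE_I2 isCont_tendsto_compose[of _ G] tendsto_intros X)
          (simp add: continuous_on_eq_continuous_at)
      show "AE \<eta> in lborel. norm (G (X n - \<eta>, \<eta>)) \<le> indicator {-R..R} \<eta> * M" for n
      proof (rule AE_I2)
        fix \<eta>
        show "norm (G (X n - \<eta>, \<eta>)) \<le> indicator {-R..R} \<eta> * M"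
          using M G(2)[of "(X n - \<eta>, \<eta>)"] norm_snd_le[of \<eta> "X n - \<eta>"]
          by (cases "\<eta> \<in> {-R..R}") auto
      qed
    qed (use cG in \<open>auto intro!: borel_measurable_continuous_onI\<close>)
  qed
  then show ?thesis by (simp add: continuous_at_imp_continuous_on)
qed

text \<open>By inversion the transform of the bilinear integral is 2 pi times its diagonal
  amplitude, and the constant in \<open>mult_op\<close> cancels the 2 pi. The multiplier thus acts
  as the factor e^{ita(\<xi> + \<eta>)} on the planar integrand.\<close>

lemma mult_op_LINT_diagonal:
  assumes G: "continuous_on UNIV G" "\<And>p. norm p > R \<Longrightarrow> G p = 0" and a: "continuous_on UNIV a"
    and K: "integrable lborel (\<lambda>x. LINT p|lborel. cis (x * (fst p + snd p)) * G p)"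
  shows "mult_op a t (\<lambda>x. LINT p|lborel. cis (x * (fst p + snd p)) * G p) x
    = (LINT p|lborel. cis (x * (fst p + snd p)) * cis (t * a (fst p + snd p)) * G p)"
proof -
  have K': "(LINT p|lborel. cis (x * (fst p + snd p)) * G p) = (LINT \<zeta>|lborel. cis (x * \<zeta>) * convolve_diagonal G \<zeta>)" for x
    by (rule LINT_diagonal[OF G], assumption, intro continuous_intros)
  have "FT (\<lambda>x. LINT p|lborel. cis (x * (fst p + snd p)) * G p) \<zeta> = 2 * complex_of_real pi * convolve_diagonal G \<zeta>" for \<zeta>
    by (rule Fourier_inversion[OF continuous_on_convolve_diagonal[OF G] convolve_diagonal_zero K' K])
      (use G(2) in auto)
  then have "mult_op a t (\<lambda>x. LINT p|lborel. cis (x * (fst p + snd p)) * G p) x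
     = complex_of_real (1 / (2 * pi))
       * (LINT \<zeta>|lborel. (2 * complex_of_real pi) * (cis (x * \<zeta>) * cis (t * a \<zeta>) * convolve_diagonal G \<zeta>))"
    unfolding mult_op_def by (simp only: mult_ac)
  also have "\<dots> = (LINT \<zeta>|lborel. (cis (x * \<zeta>) * cis (t * a \<zeta>)) * convolve_diagonal G \<zeta>)"
    by (subst integral_mult_right_zero) simp
  also have "\<dots> = (LINT p|lborel. (cis (x * (fst p + snd p)) * cis (t * a (fst p + snd p))) * G p)"
    by (rule LINT_diagonal[OF G, symmetric], assumption, intro continuous_intros a)
  finally show ?thesis .
qed

section \<open>Integrability of bilinear integrals in the space variable\<close>

lemma integrable_inverse_1_plus_power2: "integrable lborel (\<lambda>x::real. inverse (1 + x\<^sup>2))"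
  using integrable_inverse_1_plus_square by (simp add: set_integrable_def)

lemma integrable_if_quadratic_decay:
  fixes h :: "real \<Rightarrow> complex"
  assumes "h \<in> borel_measurable borel" "\<And>x. norm (h x) \<le> A" "\<And>x. x\<^sup>2 * norm (h x) \<le> B"
  shows "integrable lborel h"
proof (rule Bochner_Integration.integrable_bound)
  show "integrable lborel (\<lambda>x. (A + B) * inverse (1 + x\<^sup>2))"
    by (intro integrable_mult_right integrable_inverse_1_plus_power2)
  show "AE x in lborel. norm (h x) \<le> norm ((A + B) * inverse (1 + x\<^sup>2))"
  proof (rule AE_I2)
    fix x :: real
    have pos: "1 + x\<^sup>2 > 0" by (rule add_pos_nonneg) auto
    have "norm (h x) * (1 + x\<^sup>2) \<le> A + B"
      using assms(2,3)[of x] by (simp add: algebra_simps)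
    then have "norm (h x) \<le> (A + B) * inverse (1 + x\<^sup>2)"
      using pos by (simp add: field_simps)
    then show "norm (h x) \<le> norm ((A + B) * inverse (1 + x\<^sup>2))" by simp
  qed
qed (use assms in simp)

text \<open>Here both primitives are e^{ixs}/(ix), of modulus 1/|x|. One integration by parts per
  variable therefore gives x^{-2}, while the trivial bound covers small x.\<close>

lemma integrable_diagonal_transform:
  assumes G: "mixed_deriv G G1 G2 G12" and zero: "\<And>p. norm p > R \<Longrightarrow> G p = 0"
  shows "integrable lborel (\<lambda>x. LINT p|lborel. cis (x * (fst p + snd p)) * G p)"
proof (rule integrable_if_quadratic_decay)
  have [measurable]: "convolve_diagonal G \<in> borel_measurable borel"
    by (rule borel_measurable_continuous_onI[OF continuous_on_convolve_diagonal[OF mixed_derivD(4)[OF G] zero]])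
  have "(LINT p|lborel. cis (x * (fst p + snd p)) * G p) = (LINT \<zeta>|lborel. cis (x * \<zeta>) * convolve_diagonal G \<zeta>)" for x
    by (rule LINT_diagonal[OF mixed_derivD(4)[OF G] zero], assumption, intro continuous_intros)
  then show "(\<lambda>x. LINT p|lborel. cis (x * (fst p + snd p)) * G p) \<in> borel_measurable borel"
    by simp
  show "norm (LINT p|lborel. cis (x * (fst p + snd p)) * G p) \<le> (LINT p|lborel. norm (G p))" for x
    using integral_norm_bound[of lborel "\<lambda>p. cis (x * (fst p + snd p)) * G p"] by (simp add: norm_mult)
  show "x\<^sup>2 * norm (LINT p|lborel. cis (x * (fst p + snd p)) * G p) \<le> (LINT p|lborel. norm (G12 p))" for x
  proof (cases "x = 0")
    case False
    have 1: "((\<lambda>s. cis (x * s) / (\<i> * x)) has_vector_derivative cis (x * s)) (at s)" for s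
    proof -
      have "((\<lambda>s. cis (x * s)) has_vector_derivative \<i> * complex_of_real (x * 1) * cis (x * s)) (at s)"
        by (intro has_vector_derivative_cis has_vector_derivative_mult_right has_vector_derivative_id)
      from has_vector_derivative_mult_right[OF this, of "1 / (\<i> * x)"] show ?thesis
        using False by simp
    qed
    have 2: "norm (cis (x * s) / (\<i> * x)) \<le> 1 / \<bar>x\<bar>" for s by (simp add: norm_divide norm_mult)
    have 3: "continuous_on UNIV (\<lambda>s. cis (x * s))" by (intro continuous_intros)
    have "norm (LINT p|lborel. cis (x * fst p) * cis (x * snd p) * G p) \<le> 1 / \<bar>x\<bar> * (1 / \<bar>x\<bar>) * (LINT p|lborel. norm (G12 p))"
      by (rule oscillatory_integral_bound[OF G zero 1 3 2 1 3 2])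
    also have "(\<lambda>p. cis (x * fst p) * cis (x * snd p) * G p) = (\<lambda>p. cis (x * (fst p + snd p)) * G p)"
      by (simp add: cis_mult distrib_left)
    also have "1 / \<bar>x\<bar> * (1 / \<bar>x\<bar>) * (LINT p|lborel. norm (G12 p)) = (LINT p|lborel. norm (G12 p)) / x\<^sup>2"
      by (simp add: power2_eq_square flip: abs_mult)
    finally show ?thesis using False by (simp add: pos_le_divide_eq mult.commute)
  qed simp
qed

subsection \<open>Fourier transforms of Schwartz functions and the Duhamel integral\<close>

lemma norm_cis_minus_linear_le: "norm (cis s - (1 + \<i> * complex_of_real s)) \<le> s\<^sup>2 / 2"
  using iexp_approx1[of s 1] by (simp add: cis_conv_exp power2_eq_square fact_numeral)

text \<open>The second moment controls the first-order Taylor remainder of the exponential, so the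
  difference quotient converges at the explicit rate |y - \<xi>|/2 times that moment.\<close>

lemma FT_has_vector_derivative:
  assumes h: "integrable lborel h" "integrable lborel (\<lambda>x. complex_of_real x * h x)"
    "integrable lborel (\<lambda>x. complex_of_real x ^ 2 * h x)"
  shows "(FT h has_vector_derivative FT (\<lambda>x. - \<i> * (complex_of_real x * h x)) \<xi>) (at \<xi>)"
proof -
  let ?D = "FT (\<lambda>x. - \<i> * (complex_of_real x * h x)) \<xi>"
  define M where "M = (LINT x|lborel. norm (complex_of_real x ^ 2 * h x))"
  have bound: "norm (FT h y - FT h \<xi> - (y - \<xi>) *\<^sub>R ?D) \<le> (y - \<xi>)\<^sup>2 / 2 * M" for y
  proof -
    let ?q = "\<lambda>x. cis (- (x * y)) * h x - cis (- (x * \<xi>)) * h x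
        - (y - \<xi>) *\<^sub>R (cis (- (x * \<xi>)) * (- \<i> * (complex_of_real x * h x)))"
    have int: "integrable lborel (\<lambda>x. cis (- (x * z)) * h x)"
        "integrable lborel (\<lambda>x. cis (- (x * z)) * (- \<i> * (complex_of_real x * h x)))" for z
      by (rule integrable_cis_mult; use h in simp)+
    have "FT h y - FT h \<xi> - (y - \<xi>) *\<^sub>R ?D = (LINT x|lborel. ?q x)"
      unfolding FT_def integral_scaleR_right[symmetric]
      by (simp only: Bochner_Integration.integral_diff Bochner_Integration.integrable_diff
          integrable_scaleR_right int)
    then have "norm (FT h y - FT h \<xi> - (y - \<xi>) *\<^sub>R ?D) \<le> (LINT x|lborel. norm (?q x))"
      by (simp only: integral_norm_bound)
    also have "\<dots> \<le> (LINT x|lborel. (y - \<xi>)\<^sup>2 / 2 * norm (complex_of_real x ^ 2 * h x))"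
    proof (rule integral_mono)
      show "integrable lborel (\<lambda>x. norm (?q x))"
        by (intro integrable_norm Bochner_Integration.integrable_diff integrable_scaleR_right int)
      show "integrable lborel (\<lambda>x. (y - \<xi>)\<^sup>2 / 2 * norm (complex_of_real x ^ 2 * h x))"
        by (intro integrable_mult_right integrable_norm h)
      fix x
      \<comment> \<open>Factoring out the unimodular e^{-ix\<xi>} turns \<open>?q x\<close> into the
        Taylor remainder at \<open>?s\<close> times \<open>h x\<close>.\<close>
      let ?s = "- (x * (y - \<xi>))"
      have "cis (- (x * y)) = cis (- (x * \<xi>)) * cis ?s" by (simp add: cis_mult algebra_simps)
      then have "?q x = cis (- (x * \<xi>)) * (cis ?s - (1 + \<i> * complex_of_real ?s)) * h x"
        by (simp add: algebra_simps scaleR_conv_of_real)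
      then have "norm (?q x) = norm (cis ?s - (1 + \<i> * complex_of_real ?s)) * norm (h x)"
        by (simp add: norm_mult)
      also have "\<dots> \<le> ?s\<^sup>2 / 2 * norm (h x)"
        by (intro mult_right_mono norm_cis_minus_linear_le) simp
      also have "\<dots> = (y - \<xi>)\<^sup>2 / 2 * norm (complex_of_real x ^ 2 * h x)"
        by (simp add: norm_mult norm_power power_mult_distrib)
      finally show "norm (?q x) \<le> (y - \<xi>)\<^sup>2 / 2 * norm (complex_of_real x ^ 2 * h x)" .
    qed
    also have "\<dots> = (y - \<xi>)\<^sup>2 / 2 * M" by (simp add: M_def)
    finally show ?thesis .
  qed
  show ?thesis
    unfolding has_vector_derivative_def
  proof (rule has_derivativeI_sandwich[of 1 _ _ _ _ "\<lambda>y. \<bar>y - \<xi>\<bar> / 2 * M"])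
    show "bounded_linear (\<lambda>u. u *\<^sub>R ?D)" by (rule bounded_linear_scaleR_left)
    show "norm (FT h y - FT h \<xi> - (y - \<xi>) *\<^sub>R ?D) / norm (y - \<xi>) \<le> \<bar>y - \<xi>\<bar> / 2 * M" if "y \<noteq> \<xi>" for y
    proof -
      have "(y - \<xi>)\<^sup>2 / 2 * M = \<bar>y - \<xi>\<bar> / 2 * M * norm (y - \<xi>)"
        unfolding power2_eq_square abs_mult_self_eq[of "y - \<xi>", symmetric] by simp
      then show ?thesis using bound[of y] that by (simp only: pos_divide_le_eq zero_less_norm_iff right_minus_eq not_False_eq_True)
    qed
    have "((\<lambda>y. \<bar>y - \<xi>\<bar> / 2 * M) \<longlongrightarrow> \<bar>\<xi> - \<xi>\<bar> / 2 * M) (at \<xi>)" by (intro tendsto_intros) simp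
    then show "((\<lambda>y. \<bar>y - \<xi>\<bar> / 2 * M) \<longlongrightarrow> 0) (at \<xi>)" by simp
  qed simp
qed

lemma schwartz_moment_integrable:
  assumes "schwartz f"
  shows "integrable lborel (\<lambda>x. complex_of_real x ^ k * f x)"
proof -
  obtain D where D: "D 0 = f" "\<And>n x. (D n has_vector_derivative D (Suc n) x) (at x)"
      "\<And>n k. \<exists>C. \<forall>x. \<bar>x\<bar> ^ k * norm (D n x) \<le> C"
    using assms unfolding schwartz_def by blast
  obtain A where A: "\<And>x. \<bar>x\<bar> ^ k * norm (f x) \<le> A" using D(1) D(3)[of k 0] by auto
  \<comment> \<open>Two extra powers of x provide the quadratic decay needed for
    integrability.\<close>
  obtain B where B: "\<And>x. \<bar>x\<bar> ^ (k + 2) * norm (f x) \<le> B" using D(1) D(3)[of "k + 2" 0] by auto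
  have "continuous_on UNIV f"
    using D(2)[of 0] unfolding D(1) by (intro continuous_on_vector_derivative) simp
  then have cont: "continuous_on UNIV (\<lambda>x. complex_of_real x ^ k * f x)"
    by (intro continuous_intros)
  show ?thesis
  proof (rule integrable_if_quadratic_decay)
    show "(\<lambda>x. complex_of_real x ^ k * f x) \<in> borel_measurable borel"
      using cont by (rule borel_measurable_continuous_onI)
    show "norm (complex_of_real x ^ k * f x) \<le> A" for x
      using A[of x] by (simp add: norm_mult norm_power)
    show "x\<^sup>2 * norm (complex_of_real x ^ k * f x) \<le> B" for x
    proof -
      have "x\<^sup>2 * norm (complex_of_real x ^ k * f x) = \<bar>x\<bar> ^ (k + 2) * norm (f x)"
        unfolding power_add power2_abs by (simp add: norm_mult norm_power)
      then show ?thesis using B by simp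
    qed
  qed
qed

text \<open>Continuity of the derivative is obtained by differentiating once more, which is why
  moments up to order three appear.\<close>

lemma FT_schwartz_C1:
  assumes "schwartz f"
  obtains F' where "\<And>\<xi>. (FT f has_vector_derivative F' \<xi>) (at \<xi>)" "continuous_on UNIV F'"
proof -
  note i = schwartz_moment_integrable[OF assms]
  let ?g = "\<lambda>x. - \<i> * (complex_of_real x * f x)"
  have "(FT f has_vector_derivative FT ?g \<xi>) (at \<xi>)" for \<xi>
    by (rule FT_has_vector_derivative) (use i[of 0] i[of 1] i[of 2] in simp_all)
  moreover have "(FT ?g has_vector_derivative FT (\<lambda>x. - \<i> * (complex_of_real x * ?g x)) \<xi>) (at \<xi>)" for \<xi>
  proof (rule FT_has_vector_derivative)
    have "integrable lborel (\<lambda>x. - \<i> * (complex_of_real x ^ k * f x))" for k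
      by (rule integrable_mult_right) (rule i)
    from this[of 1] this[of 2] this[of 3]
    show "integrable lborel ?g" "integrable lborel (\<lambda>x. complex_of_real x * ?g x)"
      "integrable lborel (\<lambda>x. complex_of_real x ^ 2 * ?g x)"
      by (simp_all add: power2_eq_square power3_eq_cube mult_ac)
  qed
  then have "continuous_on UNIV (FT ?g)"
    by (intro continuous_on_vector_derivative) simp
  ultimately show thesis by (rule that)
qed

section \<open>Exact integration in time\<close>

lemma LBINT_cis:
  fixes t :: real
  assumes "0 \<le> t" "\<theta> \<noteq> 0"
  shows "(LINT s|lborel. indicator {0..t} s *\<^sub>R cis (s * \<theta>)) = - \<i> * (cis (t * \<theta>) - 1) / complex_of_real \<theta>"
proof -
  have 1: "((\<lambda>s. - \<i> / complex_of_real \<theta> * cis (s * \<theta>)) has_vector_derivative cis (s * \<theta>)) (at s)" for s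
  proof -
    have "((\<lambda>s. cis (s * \<theta>)) has_vector_derivative \<i> * complex_of_real (1 * \<theta>) * cis (s * \<theta>)) (at s)"
      by (intro has_vector_derivative_cis has_vector_derivative_mult_left has_vector_derivative_id)
    from has_vector_derivative_mult_right[OF this, of "- \<i> / complex_of_real \<theta>"] show ?thesis
      using assms(2) by simp
  qed
  have "(LINT s|lborel. indicator {0..t} s *\<^sub>R cis (s * \<theta>))
     = - \<i> / complex_of_real \<theta> * cis (t * \<theta>) - - \<i> / complex_of_real \<theta> * cis (0 * \<theta>)"
    by (rule integral_FTC_Icc[OF assms(1) has_vector_derivative_at_within[OF 1]]) (intro continuous_intros)
  then show ?thesis by (simp add: right_diff_distrib diff_divide_distrib)
qed

text \<open>The exchange is justified because the integrand is continuous and lives on the compact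
  set [0, t] times a ball.\<close>

lemma LBINT_oscillation_Fubini:
  fixes G :: "real \<times> real \<Rightarrow> complex" and t :: real
  assumes G: "continuous_on UNIV G" "\<And>p. norm p > R \<Longrightarrow> G p = 0" and h: "continuous_on UNIV h"
    and "0 \<le> t"
  shows "(LBINT s=0..t. (LINT p|lborel. G p * cis (s * h p)))
    = (LINT p|lborel. G p * (LINT s|lborel. indicator {0..t} s *\<^sub>R cis (s * h p)))"
proof -
  let ?S = "{0..t} \<times> cball (0 :: real \<times> real) R"
  have "continuous_on UNIV (\<lambda>q :: real \<times> real \<times> real. G (snd q) * cis (fst q * h (snd q)))"
    by (intro continuous_intros continuous_on_compose2[OF G(1)] continuous_on_compose2[OF h]) auto
  then have "integrable lborel (\<lambda>q. indicator ?S q *\<^sub>R (G (snd q) * cis (fst q * h (snd q))))"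
    by (intro borel_integrable_compact compact_Times) (auto intro: continuous_on_subset)
  also have "(\<lambda>q. indicator ?S q *\<^sub>R (G (snd q) * cis (fst q * h (snd q))))
      = case_prod (\<lambda>s p. indicator {0..t} s *\<^sub>R (G p * cis (s * h p)))"
  proof
    fix q :: "real \<times> real \<times> real"
    show "indicator ?S q *\<^sub>R (G (snd q) * cis (fst q * h (snd q)))
      = (case q of (s, p) \<Rightarrow> indicator {0..t} s *\<^sub>R (G p * cis (s * h p)))"
      using G(2)[of "snd q"] by (cases q, cases "norm (snd q) \<le> R") (simp_all add: indicator_times)
  qed
  finally have int: "integrable (lborel \<Otimes>\<^sub>M lborel) (case_prod (\<lambda>s p. indicator {0..t} s *\<^sub>R (G p * cis (s * h p))))"
    by (simp add: lborel_prod)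
  have "(LBINT s=0..t. (LINT p|lborel. G p * cis (s * h p)))
     = (LINT s|lborel. (LINT p|lborel. indicator {0..t} s *\<^sub>R (G p * cis (s * h p))))"
    using \<open>0 \<le> t\<close> by (simp add: interval_integral_Icc set_lebesgue_integral_def zero_ereal_def)
  also have "\<dots> = (LINT p|lborel. (LINT s|lborel. indicator {0..t} s *\<^sub>R (G p * cis (s * h p))))"
    using lborel_pair.Fubini_integral[OF int] by simp
  finally show ?thesis by (simp only: mult_scaleR_right[symmetric] integral_mult_right_zero)
qed

subsection \<open>The dispersive estimate\<close>

text \<open>The terms linear in x do not change second derivatives, so the one-dimensional phases
  satisfy van der Corput's hypothesis with t\<delta> and t\<delta>' for every x. The primitives are
  bounded by 3/sqrt(t\<delta>) and 3/sqrt(t\<delta>'), whose product is the stated constant over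
  t.\<close>

lemma LINT_bilinear_dispersive_decay:
  assumes b: "\<And>x. (b has_real_derivative b1 x) (at x)" "\<And>x. (b1 has_real_derivative b2 x) (at x)"
      "continuous_on UNIV b2" "\<delta> > 0" "\<And>x. \<delta> \<le> \<bar>b2 x\<bar>"
    and c: "\<And>x. (c has_real_derivative c1 x) (at x)" "\<And>x. (c1 has_real_derivative c2 x) (at x)"
      "continuous_on UNIV c2" "\<delta>' > 0" "\<And>x. \<delta>' \<le> \<bar>c2 x\<bar>"
    and G: "mixed_deriv G G1 G2 G12" "\<And>p. norm p > R \<Longrightarrow> G p = 0" and "t > 0"
  shows "norm (LINT p|lborel. cis (t * b (fst p) + x * fst p) * cis (t * c (snd p) + x * snd p) * G p)
    \<le> 9 / sqrt (\<delta> * \<delta>') * (LINT p|lborel. norm (G12 p)) / t"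
proof -
  have primitive: "\<exists>U. (\<forall>s. (U has_vector_derivative cis (t * h s + x * s)) (at s))
      \<and> (\<forall>s. norm (U s) \<le> 3 / sqrt (t * d)) \<and> continuous_on UNIV (\<lambda>s. cis (t * h s + x * s))"
    if h: "\<And>x. (h has_real_derivative h1 x) (at x)" "\<And>x. (h1 has_real_derivative h2 x) (at x)"
      "continuous_on UNIV h2" "d > 0" "\<And>x. d \<le> \<bar>h2 x\<bar>" for h h1 h2 :: "real \<Rightarrow> real" and d
  proof -
    have 1: "((\<lambda>s. t * h s + x * s) has_real_derivative t * h1 s + x) (at s)"
      "((\<lambda>s. t * h1 s + x) has_real_derivative t * h2 s) (at s)" for s
      by (auto intro!: derivative_eq_intros h(1,2))
    have 2: "continuous_on UNIV (\<lambda>s. t * h2 s)" "t * d > 0" "\<And>s. t * d \<le> \<bar>t * h2 s\<bar>"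
      using h(3-5) \<open>t > 0\<close> by (auto intro!: continuous_intros simp: abs_mult)
    have "continuous_on UNIV h" by (rule DERIV_continuous_on, rule has_field_derivative_at_within, rule h)
    then have "continuous_on UNIV (\<lambda>s. cis (t * h s + x * s))" by (intro continuous_intros)
    then show ?thesis using van_der_corput_primitive[OF 1 2] by metis
  qed
  obtain U where U: "\<And>s. (U has_vector_derivative cis (t * b s + x * s)) (at s)"
    "\<And>s. norm (U s) \<le> 3 / sqrt (t * \<delta>)" "continuous_on UNIV (\<lambda>s. cis (t * b s + x * s))"
    using primitive[OF b] by blast
  obtain V where V: "\<And>s. (V has_vector_derivative cis (t * c s + x * s)) (at s)"
    "\<And>s. norm (V s) \<le> 3 / sqrt (t * \<delta>')" "continuous_on UNIV (\<lambda>s. cis (t * c s + x * s))"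
    using primitive[OF c] by blast
  have "3 / sqrt (t * \<delta>) * (3 / sqrt (t * \<delta>')) = 9 / (sqrt (\<delta> * \<delta>') * (sqrt t * sqrt t))"
    by (simp add: real_sqrt_mult)
  also have "sqrt t * sqrt t = t" using \<open>t > 0\<close> by simp
  finally show ?thesis
    using oscillatory_integral_bound[OF G U(1,3,2) V(1,3,2)] by simp
qed

theorem theorem2p2:
  fixes a b c :: "real \<Rightarrow> real" and m :: "real \<times> real \<Rightarrow> complex"
    and f g :: "real \<Rightarrow> complex"
  assumes "smooth_fun a" "smooth_fun b" "smooth_fun c"
    and "hypH a" "hypH b" "hypH c"
    and "smooth_fun m" "compact (supp m)"
    and "schwartz f" "schwartz g"
    and "\<forall>p\<in>supp m. phase a b c p \<noteq> 0"
  shows "\<exists>C T0. \<forall>t\<ge>T0. \<forall>x.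
     cmod (sol a b c m f g t x
           - mult_op a t (T_bil (\<lambda>p. m p / complex_of_real (phase a b c p)) f g) x) \<le> C / t"
proof -
  obtain a1 a2 \<delta>a where a: "\<And>x. (a has_real_derivative a1 x) (at x)" "\<And>x. (a1 has_real_derivative a2 x) (at x)"
    "continuous_on UNIV a2" "\<delta>a > 0" "\<And>x. \<delta>a \<le> \<bar>a2 x\<bar>"
    using smooth_fun_hypH[OF assms(1,4)] by blast
  obtain b1 b2 \<delta> where b: "\<And>x. (b has_real_derivative b1 x) (at x)" "\<And>x. (b1 has_real_derivative b2 x) (at x)"
    "continuous_on UNIV b2" "\<delta> > 0" "\<And>x. \<delta> \<le> \<bar>b2 x\<bar>"
    using smooth_fun_hypH[OF assms(2,5)] by blast
  obtain c1 c2 \<delta>' where c: "\<And>x. (c has_real_derivative c1 x) (at x)" "\<And>x. (c1 has_real_derivative c2 x) (at x)"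
    "continuous_on UNIV c2" "\<delta>' > 0" "\<And>x. \<delta>' \<le> \<bar>c2 x\<bar>"
    using smooth_fun_hypH[OF assms(3,6)] by blast
  have cont: "continuous_on UNIV a" "continuous_on UNIV b1" "continuous_on UNIV c1"
    by (rule DERIV_continuous_on, rule has_field_derivative_at_within, rule a b c)+
  define \<phi> where "\<phi> = phase a b c"
  obtain \<phi>1 \<phi>2 \<phi>12 where \<phi>: "mixed_deriv \<phi> \<phi>1 \<phi>2 \<phi>12"
    unfolding \<phi>_def using mixed_deriv_phase[OF a(1-3) b(1) cont(2) c(1) cont(3)] by blast
  obtain m1 m2 m12 where m: "mixed_deriv m m1 m2 m12"
    using smooth_fun_mixed_deriv[OF assms(7)] by blast
  obtain R where R: "\<And>p. p \<in> supp m \<Longrightarrow> norm p \<le> R"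
    using compact_imp_bounded[OF assms(8)] by (auto simp: bounded_iff)
  have m0: "m p = 0" if "norm p > R" for p
    using R[of p] in_supp[of m p] that by force
  obtain F' where F': "\<And>\<xi>. (FT f has_vector_derivative F' \<xi>) (at \<xi>)" "continuous_on UNIV F'"
    using FT_schwartz_C1[OF assms(9)] by blast
  obtain G' where G': "\<And>\<xi>. (FT g has_vector_derivative G' \<xi>) (at \<xi>)" "continuous_on UNIV G'"
    using FT_schwartz_C1[OF assms(10)] by blast
  define P where "P = (\<lambda>p. FT f (fst p) * FT g (snd p))"
  obtain P1 P2 P12 where P: "mixed_deriv P P1 P2 P12"
    unfolding P_def using mixed_deriv_mult[OF mixed_deriv_fst[OF F'] mixed_deriv_snd[OF G']] by blast
  have "\<exists>Q1 Q2 Q12. mixed_deriv (\<lambda>p. m p / complex_of_real (\<phi> p)) Q1 Q2 Q12"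
    by (rule mixed_deriv_divide[OF m \<phi>]) (use assms(11) in \<open>simp add: \<phi>_def\<close>)
  then obtain Q1 Q2 Q12 where Q: "mixed_deriv (\<lambda>p. m p / complex_of_real (\<phi> p)) Q1 Q2 Q12" by blast
  define G where "G = (\<lambda>p. P p * (m p / complex_of_real (\<phi> p)))"
  obtain G1 G2 G12 where G: "mixed_deriv G G1 G2 G12"
    unfolding G_def using mixed_deriv_mult[OF P Q] by blast
  have G0: "G p = 0" if "norm p > R" for p using m0[OF that] by (simp add: G_def)
  \<comment> \<open>\<open>G\<close> depends on neither t nor x, hence neither does this
    constant.\<close>
  define C where "C = 9 / sqrt (\<delta> * \<delta>') * (LINT p|lborel. norm (G12 p))"
  \<comment> \<open>The threshold 1 keeps t positive.\<close>
  have "cmod (sol a b c m f g t x - mult_op a t (T_bil (\<lambda>p. m p / complex_of_real (phase a b c p)) f g) x) \<le> C / t"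
    if t: "t \<ge> 1" for t x
  proof -
    \<comment> \<open>Amplitude after the time integration: integrating e^{is\<phi>} over [0, t]
      gives -i(e^{it\<phi>} - 1)/\<phi>, and 1/\<phi> is already part of \<open>G\<close>. The
      derivatives of \<open>H\<close> may grow with t, but they are used only to get integrability
      at fixed t, so they do not affect the rate.\<close>
    define H where "H = (\<lambda>p. - \<i> * (G p * (cis (t * \<phi> p) - 1)))"
    obtain H1 H2 H12 where H: "mixed_deriv H H1 H2 H12"
      unfolding H_def
      using mixed_deriv_mult[OF mixed_deriv_const mixed_deriv_mult[OF G mixed_deriv_diff_const[OF mixed_deriv_cis[OF \<phi>]]]]
      by blast
    have H0: "H p = 0" if "norm p > R" for p using G0[OF that] by (simp add: H_def)
    have F_eq: "T_bil (\<lambda>p. m p / complex_of_real (phase a b c p)) f g = (\<lambda>y. LINT p|lborel. cis (y * (fst p + snd p)) * G p)"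
      unfolding T_bil_def G_def P_def \<phi>_def by (simp add: mult_ac)
    have Duhamel: "(LBINT s=0..t. T_bil (\<lambda>p. m p * cis (s * phase a b c p)) f g y)
        = (LINT p|lborel. cis (y * (fst p + snd p)) * H p)" for y
    proof -
      let ?G = "\<lambda>p. cis (y * (fst p + snd p)) * P p * m p"
      have "(LBINT s=0..t. T_bil (\<lambda>p. m p * cis (s * phase a b c p)) f g y)
          = (LBINT s=0..t. (LINT p|lborel. ?G p * cis (s * \<phi> p)))"
        unfolding T_bil_def P_def \<phi>_def by (simp only: mult.assoc)
      also have "\<dots> = (LINT p|lborel. ?G p * (LINT s|lborel. indicator {0..t} s *\<^sub>R cis (s * \<phi> p)))"
        by (rule LBINT_oscillation_Fubini[where R = R])
          (use t m0 in \<open>auto intro!: continuous_intros mixed_derivD(4)[OF P] mixed_derivD(4)[OF m] mixed_derivD(4)[OF \<phi>]\<close>)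
      also have "\<dots> = (LINT p|lborel. cis (y * (fst p + snd p)) * H p)"
      proof (intro Bochner_Integration.integral_cong refl)
        fix p
        show "?G p * (LINT s|lborel. indicator {0..t} s *\<^sub>R cis (s * \<phi> p)) = cis (y * (fst p + snd p)) * H p"
        \<comment> \<open>The phase may vanish where \<open>m\<close> does; there both sides are 0,
          and elsewhere the point lies in \<open>supp m\<close>.\<close>
        proof (cases "m p = 0")
          case False
          then have "\<phi> p \<noteq> 0" using assms(11) in_supp[of m p] by (simp add: \<phi>_def)
          then show ?thesis using LBINT_cis[of t "\<phi> p"] t by (simp add: H_def G_def)
        qed (simp add: H_def G_def)
      qed
      finally show ?thesis .
    qed
    define A where "A = (\<lambda>p :: real \<times> real. cis (x * (fst p + snd p)) * cis (t * a (fst p + snd p)))"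
    have contA: "continuous_on UNIV A"
      unfolding A_def by (intro continuous_intros continuous_on_compose2[OF cont(1)]) auto
    have int: "integrable lborel (\<lambda>p. A p * G p)" "integrable lborel (\<lambda>p. A p * H p)"
      by (rule integrable_continuous_compact_support[where R = R],
          intro continuous_on_mult contA mixed_derivD(4)[OF G] mixed_derivD(4)[OF H], simp add: G0 H0)+
    have "sol a b c m f g t x = - \<i> * (LINT p|lborel. A p * H p)"
      unfolding sol_def Duhamel A_def
      by (subst mult_op_LINT_diagonal[OF mixed_derivD(4)[OF H] H0 cont(1) integrable_diagonal_transform[OF H H0]]) auto
    moreover have "mult_op a t (T_bil (\<lambda>p. m p / complex_of_real (phase a b c p)) f g) x = (LINT p|lborel. A p * G p)"
      unfolding F_eq A_def
      by (subst mult_op_LINT_diagonal[OF mixed_derivD(4)[OF G] G0 cont(1) integrable_diagonal_transform[OF G G0]]) auto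
    ultimately have "sol a b c m f g t x - mult_op a t (T_bil (\<lambda>p. m p / complex_of_real (phase a b c p)) f g) x
        = (LINT p|lborel. - \<i> * (A p * H p) - A p * G p)"
      using int by simp
    also have "\<dots> = (LINT p|lborel. - (cis (t * b (fst p) + x * fst p) * cis (t * c (snd p) + x * snd p) * G p))"
    proof (intro Bochner_Integration.integral_cong refl)
      fix p
      \<comment> \<open>The two factors -i multiply to -1, so the contribution of the endpoint s = 0
        is exactly \<open>A p * G p\<close>; subtracting the profile F removes it and leaves the
        endpoint s = t.\<close>
      have "- \<i> * (A p * H p) - A p * G p = - (A p * cis (t * \<phi> p) * G p)"
        by (simp add: H_def algebra_simps)
      \<comment> \<open>The term t a(\<xi> + \<eta>) cancels against the one in t\<phi>, and x(\<xi>
        + \<eta>) splits, so the exponential factorises.\<close>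
      also have "A p * cis (t * \<phi> p) = cis (t * b (fst p) + x * fst p) * cis (t * c (snd p) + x * snd p)"
        by (simp add: A_def \<phi>_def phase_def cis_mult algebra_simps)
      finally show "- \<i> * (A p * H p) - A p * G p
        = - (cis (t * b (fst p) + x * fst p) * cis (t * c (snd p) + x * snd p) * G p)" .
    qed
    finally show ?thesis
      using LINT_bilinear_dispersive_decay[where R = R and t = t and x = x, OF b c G G0] t by (simp add: C_def)
  qed
  then show ?thesis by blast
qed

end
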